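(* Let $S_n=(\mathcal{V},(m_i)_{0\le i\le n-1})$ be a locally finite weighted oriented $n$-simplicial complex. Assume: (i) there exist finite sets $O_k\subset\mathcal{V}$ ($k\ge 1$) with $O_k\nearrow\mathcal{V}$ and functions $\chi_k:\mathcal{V}\to[0,1]$ such that, for every $k$, $\chi_k$ has finite support and $\chi_k(x)=1$ for every $x\in O_k$; (ii) for every $i\in\{0,1,\dots,n-2\}$, $\sup_\sigma d_{m_i}(\sigma)<\infty$, the supremum being over all $i$-simplices $\sigma$. (In particular these hold if $S_n$ is globally $\chi$-complete and $\sup_\sigma d_{m_i}(\sigma)<\infty$ for every $i\in\{0,\dots,n-2\}$.) Then the Hodge Laplacian $L=D^2=\bigoplus_{i=0}^{n-1}L_i$ is essentially self-adjoint on $\bigoplus_{i=0}^{n-1}C_c^i(\mathcal{V})$ (as an operator in $\mathcal{H}$).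
   Context: Complex. $\mathcal{V}$ is a countable set, $m_0:\mathcal{V}\to(0,\infty)$, and $m_1:\mathcal{V}\times\mathcal{V}\to[0,\infty)$ is symmetric with $m_1(x,x)=0$. Write $x\sim y$ (neighbours) if $m_1(x,y)>0$. Locally finite means every vertex has finitely many neighbours. Fix an integer $n\ge2$. For $0\le i\le n-1$, $\mathcal{F}_i$ is the set of ordered tuples $(x_0,\dots,x_i)$ of pairwise adjacent vertices (cliques); these are the $i$-simplices. $P_i$ is the quotient of $\mathcal{F}_i$ by even permutations; $-\tau$ denotes the opposite orientation of $\tau\in P_i$. The weights $m_i:\mathcal{V}^{i+1}\to[0,\infty)$, $0\le i\le n-1$, are invariant under all permutations and positive exactly on $\mathcal{F}_i$. $S_n=(\mathcal{V},(m_i)_{0\le i\le n-1})$ is the weighted oriented $n$-simplicial complex (simplices have at most $n$ vertices). For $1\le i\le n-1$ and an $(i-1)$-simplex, $F(x_0,\dots,x_{i-1})$ is the set of common neighbours of $x_0,\dots,x_{i-1}$, and the weighted degree is $$d_{m_{i-1}}(x_0,\dots,x_{i-1})=\frac1{m_{i-1}(x_0,\dots,x_{i-1})}\sum_{x_i\in F(x_0,\dots,x_{i-1})}m_i(x_0,\dots,x_i).$$ Cochains. $C_c^i(\mathcal{V})$ is the space of finitely supported $f:P_i\to\mathbb{C}$ with $f(-\tau)=-f(\tau)$ (alternating functions on $\mathcal{F}_i$), with inner product $\langle f,g\rangle_{\ell^2(m_i)}=\frac1{(i+1)!}\sum_{(x_0,\dots,x_i)\in\mathcal{F}_i}m_i(x_0,\dots,x_i)\overline{f(x_0,\dots,x_i)}g(x_0,\dots,x_i)$;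 $\ell^2(m_i)$ is its completion and $\mathcal{H}=\bigoplus_{i=0}^{n-1}\ell^2(m_i)$. Operators. For $0\le i\le n-2$, $d_if(x_0,\dots,x_{i+1})=\sum_{j=0}^{i+1}(-1)^jf(x_0,\dots,\widehat{x_j},\dots,x_{i+1})$. For $1\le i\le n-1$, $$\delta_ig(x_0,\dots,x_{i-1})=\frac{(-1)^i}{m_{i-1}(x_0,\dots,x_{i-1})}\sum_{x_i\in F(x_0,\dots,x_{i-1})}m_i(x_0,\dots,x_i)g(x_0,\dots,x_i).$$ $D=d+\delta$ acts on $F=(f_0,\dots,f_{n-1})$ by $(DF)_i=d_{i-1}f_{i-1}+\delta_{i+1}f_{i+1}$ (terms with index out of range are $0$), and maps $\bigoplus_iC_c^i(\mathcal{V})$ into itself. $L=D^2$ is block diagonal with blocks $L_i=d_{i-1}\delta_i+\delta_{i+1}d_i$, with the conventions $\delta_0=0$, $d_{n-1}=0$. $\chi$-completeness. $O_k\nearrow\mathcal{V}$ means the $O_k$ increase with union $\mathcal{V}$. For $\chi:\mathcal{V}\to[0,1]$ and $1\le\ell\le n-1$ the energy at level $\ell$ is $$E_\ell(\chi)=\frac1{\ell!}\sum_{(x_0,\dots,x_{\ell-1})\in P_{\ell-1}^+}\frac1{m_{\ell-1}(x_0,\dots,x_{\ell-1})}\sum_{x_\ell\in F(x_0,\dots,x_{\ell-1})}m_\ell(x_0,\dots,x_\ell)\sum_{j=0}^\ell|a_j|^2,$$ where $P_{\ell-1}^+$ contains exactly one orientation of each $(\ell-1)$-simplex and $a_j=\frac{S-(\ell+1)\chi(x_j)}{\ell(\ell+1)}$,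 $S=\sum_{k=0}^\ell\chi(x_k)$. $S_n$ is globally $\chi$-complete if there are finite sets $O_k\nearrow\mathcal{V}$ ($k\in\mathbb{N}$), functions $\chi_k:\mathcal{V}\to[0,1]$ and a constant $C>0$ such that for all $k$ and all $1\le\ell\le n-1$: $\chi_k$ has finite support, $\chi_k=1$ on $O_k$, and $E_\ell(\chi_k)\le C$. *)

theory Defs
  imports
    "HOL-Analysis.Analysis"
    "HOL-Combinatorics.Permutations"
    "HOL-Library.Function_Algebras"
begin

section \<open>Weighted simplicial complexes\<close>

text \<open>
  Tuples of vertices \<open>(x\<^sub>0, \<dots>, x\<^sub>i)\<close> are lists of length \<open>i + 1\<close>, and \<open>m i\<close> is the weight \<open>m\<^sub>i\<close>;
  only its values on lists over \<open>V\<close> of length \<open>i + 1\<close>, with \<open>i < n\<close>, are ever relevant.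
\<close>

type_synonym 'v weights = "nat \<Rightarrow> 'v list \<Rightarrow> real"

definition adjacent :: "'v weights \<Rightarrow> 'v \<Rightarrow> 'v \<Rightarrow> bool" where
  "adjacent m x y \<longleftrightarrow> m 1 [x, y] > 0"

definition simplices :: "'v set \<Rightarrow> 'v weights \<Rightarrow> nat \<Rightarrow> 'v list set" where
  "simplices V m i = {xs. length xs = i + 1 \<and> set xs \<subseteq> V \<and>
     (\<forall>j < length xs. \<forall>k < length xs. j \<noteq> k \<longrightarrow> adjacent m (xs ! j) (xs ! k))}"

text \<open>
  Since adjacency is read off \<open>m 1\<close>, positivity of \<open>m\<^sub>1\<close> exactly on the 1-simplices does not
  force \<open>m\<^sub>1(x, x) = 0\<close>, which therefore is a separate axiom. Symmetry of \<open>m\<^sub>1\<close> and positivity of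
  \<open>m\<^sub>0\<close> on \<open>V\<close> are instances of the last two axioms.
\<close>

locale weighted_complex =
  fixes V :: "'v set" and n :: nat and m :: "'v weights"
  assumes countable_vertices: "countable V"
    and n_ge_2: "n \<ge> 2"
    and no_loops: "x \<in> V \<Longrightarrow> m 1 [x, x] = 0"
    and weight_nonneg: "i < n \<Longrightarrow> length xs = i + 1 \<Longrightarrow> set xs \<subseteq> V \<Longrightarrow> m i xs \<ge> 0"
    and weight_pos_iff:
      "i < n \<Longrightarrow> length xs = i + 1 \<Longrightarrow> set xs \<subseteq> V \<Longrightarrow> m i xs > 0 \<longleftrightarrow> xs \<in> simplices V m i"
    and weight_permute:
      "i < n \<Longrightarrow> length xs = i + 1 \<Longrightarrow> set xs \<subseteq> V \<Longrightarrow> p permutes {..<length xs}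
        \<Longrightarrow> m i (permute_list p xs) = m i xs"

definition locally_finite :: "'v set \<Rightarrow> 'v weights \<Rightarrow> bool" where
  "locally_finite V m \<longleftrightarrow> (\<forall>x\<in>V. finite {y \<in> V. adjacent m x y})"

definition common_neighbours :: "'v set \<Rightarrow> 'v weights \<Rightarrow> 'v list \<Rightarrow> 'v set" where
  "common_neighbours V m xs = {y \<in> V. \<forall>x \<in> set xs. adjacent m x y}"

text \<open>\<open>weighted_degree V m i\<close> is \<open>d\<^bsub>m\<^sub>i\<^esub>\<close>, a function of the \<open>i\<close>-simplices.\<close>

definition weighted_degree :: "'v set \<Rightarrow> 'v weights \<Rightarrow> nat \<Rightarrow> 'v list \<Rightarrow> real" where
  "weighted_degree V m i xs =
     1 / m i xs * (\<Sum>y \<in> common_neighbours V m xs. m (i + 1) (xs @ [y]))"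

section \<open>Cochains and the ambient Hilbert space\<close>

text \<open>
  An odd function on oriented \<open>i\<close>-simplices is an alternating function of the ordered ones. It is
  extended by \<open>0\<close> to all lists, so that equality of cochains is equality of HOL functions.
\<close>

definition alternating :: "'v set \<Rightarrow> 'v weights \<Rightarrow> nat \<Rightarrow> ('v list \<Rightarrow> complex) set" where
  "alternating V m i = {f. (\<forall>xs. xs \<notin> simplices V m i \<longrightarrow> f xs = 0) \<and>
     (\<forall>xs \<in> simplices V m i. \<forall>p. p permutes {..<length xs} \<longrightarrow>
        f (permute_list p xs) = of_int (sign p) * f xs)}"

definition cochains_c :: "'v set \<Rightarrow> 'v weights \<Rightarrow> nat \<Rightarrow> ('v list \<Rightarrow> complex) set" where
  "cochains_c V m i = {f \<in> alternating V m i. finite {xs. f xs \<noteq> 0}}"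

definition inner_l2 ::
    "'v set \<Rightarrow> 'v weights \<Rightarrow> nat \<Rightarrow> ('v list \<Rightarrow> complex) \<Rightarrow> ('v list \<Rightarrow> complex) \<Rightarrow> complex" where
  "inner_l2 V m i f g = 1 / fact (i + 1) *
     (\<Sum>\<^sub>\<infinity>xs \<in> simplices V m i. of_real (m i xs) * cnj (f xs) * g xs)"

text \<open>
  The completion of \<open>cochains_c V m i\<close> for \<open>inner_l2 V m i\<close>, realised as the space of
  square-summable alternating functions.
\<close>

definition l2 :: "'v set \<Rightarrow> 'v weights \<Rightarrow> nat \<Rightarrow> ('v list \<Rightarrow> complex) set" where
  "l2 V m i = {f \<in> alternating V m i.
     (\<lambda>xs. m i xs * (cmod (f xs))\<^sup>2) summable_on simplices V m i}"

text \<open>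
  Elements \<open>(f\<^sub>0, \<dots>, f\<^sub>n\<^sub>-\<^sub>1)\<close> of the direct sums are functions of the degree, zero from \<open>n\<close> on.
\<close>

definition total_cochains_c :: "'v set \<Rightarrow> nat \<Rightarrow> 'v weights \<Rightarrow> (nat \<Rightarrow> 'v list \<Rightarrow> complex) set" where
  "total_cochains_c V n m = {F. (\<forall>i<n. F i \<in> cochains_c V m i) \<and> (\<forall>i\<ge>n. F i = 0)}"

definition total_l2 :: "'v set \<Rightarrow> nat \<Rightarrow> 'v weights \<Rightarrow> (nat \<Rightarrow> 'v list \<Rightarrow> complex) set" where
  "total_l2 V n m = {F. (\<forall>i<n. F i \<in> l2 V m i) \<and> (\<forall>i\<ge>n. F i = 0)}"

definition total_inner ::
    "'v set \<Rightarrow> nat \<Rightarrow> 'v weights \<Rightarrow> (nat \<Rightarrow> 'v list \<Rightarrow> complex) \<Rightarrow> (nat \<Rightarrow> 'v list \<Rightarrow> complex) \<Rightarrow> complex"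
  where "total_inner V n m F G = (\<Sum>i<n. inner_l2 V m i (F i) (G i))"

section \<open>The operators\<close>

definition remove_nth :: "nat \<Rightarrow> 'a list \<Rightarrow> 'a list" where
  "remove_nth j xs = take j xs @ drop (Suc j) xs"

definition coboundary ::
    "'v set \<Rightarrow> 'v weights \<Rightarrow> nat \<Rightarrow> ('v list \<Rightarrow> complex) \<Rightarrow> 'v list \<Rightarrow> complex" where
  "coboundary V m i f xs =
     (if xs \<in> simplices V m (i + 1) then \<Sum>j\<le>i + 1. (-1) ^ j * f (remove_nth j xs) else 0)"

definition codifferential ::
    "'v set \<Rightarrow> 'v weights \<Rightarrow> nat \<Rightarrow> ('v list \<Rightarrow> complex) \<Rightarrow> 'v list \<Rightarrow> complex" where
  "codifferential V m i g xs =
     (if xs \<in> simplices V m (i - 1)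
      then (-1) ^ i / of_real (m (i - 1) xs) *
        (\<Sum>y \<in> common_neighbours V m xs. of_real (m i (xs @ [y])) * g (xs @ [y]))
      else 0)"

definition gauss_bonnet ::
    "'v set \<Rightarrow> nat \<Rightarrow> 'v weights \<Rightarrow> (nat \<Rightarrow> 'v list \<Rightarrow> complex) \<Rightarrow> nat \<Rightarrow> 'v list \<Rightarrow> complex" where
  "gauss_bonnet V n m F i =
     (if 1 \<le> i \<and> i < n then coboundary V m (i - 1) (F (i - 1)) else 0) +
     (if i + 1 < n then codifferential V m (i + 1) (F (i + 1)) else 0)"

definition hodge_laplacian ::
    "'v set \<Rightarrow> nat \<Rightarrow> 'v weights \<Rightarrow> (nat \<Rightarrow> 'v list \<Rightarrow> complex) \<Rightarrow> nat \<Rightarrow> 'v list \<Rightarrow> complex" where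
  "hodge_laplacian V n m F = gauss_bonnet V n m (gauss_bonnet V n m F)"

definition hodge_block ::
    "'v set \<Rightarrow> nat \<Rightarrow> 'v weights \<Rightarrow> nat \<Rightarrow> ('v list \<Rightarrow> complex) \<Rightarrow> 'v list \<Rightarrow> complex" where
  "hodge_block V n m i f =
     (if 1 \<le> i then coboundary V m (i - 1) (codifferential V m i f) else 0) +
     (if i + 1 < n then codifferential V m (i + 1) (coboundary V m i f) else 0)"

section \<open>Unbounded operators\<close>

text \<open>
  A Hilbert space is given by its carrier \<open>H\<close> and an inner product \<open>ip\<close>, conjugate-linear in the
  first argument. Adjoint and closure are formed on graphs of operators, as subsets of \<open>H \<times> H\<close>.
\<close>

definition hnorm :: "('a \<Rightarrow> 'a \<Rightarrow> complex) \<Rightarrow> 'a \<Rightarrow> real" where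
  "hnorm ip u = sqrt (Re (ip u u))"

definition linear_operator_on ::
    "('i \<Rightarrow> 'j \<Rightarrow> complex) set \<Rightarrow> (('i \<Rightarrow> 'j \<Rightarrow> complex) \<Rightarrow> 'i \<Rightarrow> 'j \<Rightarrow> complex) \<Rightarrow> bool" where
  "linear_operator_on A T \<longleftrightarrow> 0 \<in> A \<and>
     (\<forall>F\<in>A. \<forall>G\<in>A. F + G \<in> A \<and> T (F + G) = T F + T G) \<and>
     (\<forall>c. \<forall>F\<in>A. (\<lambda>i j. c * F i j) \<in> A \<and> T (\<lambda>i j. c * F i j) = (\<lambda>i j. c * T F i j))"

definition graph_on :: "'a set \<Rightarrow> ('a \<Rightarrow> 'a) \<Rightarrow> ('a \<times> 'a) set" where
  "graph_on A T = (\<lambda>u. (u, T u)) ` A"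

definition dense_in :: "'a::minus set \<Rightarrow> ('a \<Rightarrow> 'a \<Rightarrow> complex) \<Rightarrow> 'a set \<Rightarrow> bool" where
  "dense_in H ip A \<longleftrightarrow> (\<forall>u\<in>H. \<forall>e>0. \<exists>f\<in>A. hnorm ip (f - u) < e)"

definition adjoint_graph :: "'a set \<Rightarrow> ('a \<Rightarrow> 'a \<Rightarrow> complex) \<Rightarrow> ('a \<times> 'a) set \<Rightarrow> ('a \<times> 'a) set" where
  "adjoint_graph H ip G =
     {(u, v). u \<in> H \<and> v \<in> H \<and> (\<forall>(f, g) \<in> G. ip u g = ip v f)}"

definition closure_graph ::
    "'a::minus set \<Rightarrow> ('a \<Rightarrow> 'a \<Rightarrow> complex) \<Rightarrow> ('a \<times> 'a) set \<Rightarrow> ('a \<times> 'a) set" where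
  "closure_graph H ip G = {(u, v). u \<in> H \<and> v \<in> H \<and>
     (\<exists>f g. (\<forall>k::nat. (f k, g k) \<in> G) \<and>
        (\<lambda>k. hnorm ip (f k - u)) \<longlonglongrightarrow> 0 \<and> (\<lambda>k. hnorm ip (g k - v)) \<longlonglongrightarrow> 0)}"

text \<open>
  The closure of \<open>T\<close> is self-adjoint. As \<open>A\<close> is dense, the adjoint of the closure is
  single-valued, so the equation of graphs includes closability of \<open>T\<close>.
\<close>

definition essentially_self_adjoint ::
    "('i \<Rightarrow> 'j \<Rightarrow> complex) set \<Rightarrow> (('i \<Rightarrow> 'j \<Rightarrow> complex) \<Rightarrow> ('i \<Rightarrow> 'j \<Rightarrow> complex) \<Rightarrow> complex)
     \<Rightarrow> ('i \<Rightarrow> 'j \<Rightarrow> complex) set \<Rightarrow> (('i \<Rightarrow> 'j \<Rightarrow> complex) \<Rightarrow> 'i \<Rightarrow> 'j \<Rightarrow> complex) \<Rightarrow> bool" where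
  "essentially_self_adjoint H ip A T \<longleftrightarrow>
     A \<subseteq> H \<and> T ` A \<subseteq> H \<and> linear_operator_on A T \<and> dense_in H ip A \<and>
     adjoint_graph H ip (closure_graph H ip (graph_on A T)) = closure_graph H ip (graph_on A T)"

section \<open>Completeness\<close>

text \<open>
  \<open>K\<close> is the index set of the sequences. The cutoff functions are written \<open>\<eta>\<close>, because chi is
  a binder in HOL-Analysis.
\<close>

definition cutoff_exhaustion ::
    "nat set \<Rightarrow> 'v set \<Rightarrow> (nat \<Rightarrow> 'v set) \<Rightarrow> (nat \<Rightarrow> 'v \<Rightarrow> real) \<Rightarrow> bool" where
  "cutoff_exhaustion K V W \<eta> \<longleftrightarrow>
     (\<forall>k\<in>K. finite (W k)) \<and> mono_on K W \<and> (\<Union>k\<in>K. W k) = V \<and>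
     (\<forall>k\<in>K. (\<forall>x\<in>V. 0 \<le> \<eta> k x \<and> \<eta> k x \<le> 1) \<and> finite {x \<in> V. \<eta> k x \<noteq> 0} \<and> (\<forall>x\<in>W k. \<eta> k x = 1))"

text \<open>
  One ordering, hence one orientation, of each unoriented simplex; the energy does not depend on
  the choice.
\<close>

definition positive_simplices :: "'v set \<Rightarrow> 'v weights \<Rightarrow> nat \<Rightarrow> 'v list set" where
  "positive_simplices V m i =
     (\<lambda>s. SOME xs. xs \<in> simplices V m i \<and> set xs = s) ` set ` simplices V m i"

definition energy_coeff :: "nat \<Rightarrow> ('v \<Rightarrow> real) \<Rightarrow> 'v list \<Rightarrow> nat \<Rightarrow> real" where
  "energy_coeff l \<eta> xs j =
     ((\<Sum>k\<le>l. \<eta> (xs ! k)) - real (l + 1) * \<eta> (xs ! j)) / (real l * real (l + 1))"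

definition energy :: "'v set \<Rightarrow> 'v weights \<Rightarrow> nat \<Rightarrow> ('v \<Rightarrow> real) \<Rightarrow> ennreal" where
  "energy V m l \<eta> = ennreal (1 / fact l) *
     (\<Sum>\<^sub>\<infinity>xs \<in> positive_simplices V m (l - 1). ennreal (1 / m (l - 1) xs *
        (\<Sum>y \<in> common_neighbours V m xs. m l (xs @ [y]) *
           (\<Sum>j\<le>l. \<bar>energy_coeff l \<eta> (xs @ [y]) j\<bar>\<^sup>2))))"

definition globally_chi_complete :: "'v set \<Rightarrow> nat \<Rightarrow> 'v weights \<Rightarrow> bool" where
  "globally_chi_complete V n m \<longleftrightarrow>
     (\<exists>W \<eta>. \<exists>C>0. cutoff_exhaustion UNIV V W \<eta> \<and>
        (\<forall>k. \<forall>l \<in> {1..n - 1}. energy V m l (\<eta> k) \<le> ennreal C))"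

end

theory Submission
  imports Defs
begin

text \<open>
  The bound on the weighted degrees makes the Gauss-Bonnet operator \<open>D = d + \<delta>\<close> a bounded operator on
  the whole Hilbert space. Indeed \<open>|df|\<^sup>2\<close> at an \<open>(i + 1)\<close>-simplex is at most \<open>i + 2\<close> times the sum of
  \<open>|f|\<^sup>2\<close> over its faces, and weighting this by \<open>m\<^sub>i\<^sub>+\<^sub>1\<close> and summing over the simplices collects, for
  each face \<open>\<sigma>\<close>, the total weight of the simplices above \<open>\<sigma>\<close>, which is \<open>m\<^sub>i(\<sigma>) d\<^bsub>m\<^sub>i\<^esub>(\<sigma>)\<close>. The operator
  \<open>\<delta>\<close> is controlled by the Cauchy-Schwarz inequality and the same identity
  (\<open>coboundary_l2\<close>, \<open>codifferential_l2\<close>). All series involved converge absolutely, so Fubini's theorem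
  shows that \<open>d\<close> and \<open>\<delta>\<close> are adjoint to each other on all square-summable cochains
  (\<open>inner_coboundary_eq_inner_codifferential\<close>). Hence \<open>D\<close>, and with it \<open>L = D\<^sup>2\<close>, is bounded and
  symmetric on the whole space.

  A bounded everywhere defined symmetric operator is essentially self-adjoint on any dense
  subspace: its graph over the subspace has the graph over the whole space as its closure, and
  the latter is its own adjoint because the inner product is nondegenerate
  (\<open>bounded_symmetric_essentially_self_adjoint\<close>). Finitely supported cochains are dense, since a
  square-summable cochain may be cut off to the simplices with all vertices in a large finite set
  without losing the alternating property (\<open>total_cochains_c_dense\<close>).

  The block form of \<open>L\<close> is \<open>d\<^sup>2 = 0\<close> together with \<open>\<delta>\<^sup>2 = 0\<close>. The work with tuples lies in showing that
  \<open>d\<close> and \<open>\<delta>\<close> preserve alternating functions, and in bringing an arbitrary face of a simplex into the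
  position where the last vertex is omitted, at the price of a sign.
\<close>

section \<open>Bounded symmetric operators\<close>

locale function_inner_product_space =
  fixes H :: "('i \<Rightarrow> 'j \<Rightarrow> complex) set"
    and ip :: "('i \<Rightarrow> 'j \<Rightarrow> complex) \<Rightarrow> ('i \<Rightarrow> 'j \<Rightarrow> complex) \<Rightarrow> complex"
  assumes zero_mem: "0 \<in> H"
    and add_mem: "\<lbrakk>F \<in> H; G \<in> H\<rbrakk> \<Longrightarrow> F + G \<in> H"
    and scale_mem: "F \<in> H \<Longrightarrow> (\<lambda>i j. c * F i j) \<in> H"
    and ip_add_right: "\<lbrakk>F \<in> H; G \<in> H; K \<in> H\<rbrakk> \<Longrightarrow> ip F (G + K) = ip F G + ip F K"
    and ip_scale_right: "\<lbrakk>F \<in> H; G \<in> H\<rbrakk> \<Longrightarrow> ip F (\<lambda>i j. c * G i j) = c * ip F G"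
    and ip_cnj: "\<lbrakk>F \<in> H; G \<in> H\<rbrakk> \<Longrightarrow> ip G F = cnj (ip F G)"
    and ip_nonneg: "F \<in> H \<Longrightarrow> 0 \<le> Re (ip F F)"
    and ip_definite: "\<lbrakk>F \<in> H; Re (ip F F) = 0\<rbrakk> \<Longrightarrow> F = 0"
begin

lemma diff_eq_add_scale: "(F :: 'i \<Rightarrow> 'j \<Rightarrow> complex) - G = F + (\<lambda>i j. -1 * G i j)"
  by (simp add: fun_eq_iff)

lemma diff_mem: "\<lbrakk>F \<in> H; G \<in> H\<rbrakk> \<Longrightarrow> F - G \<in> H"
  unfolding diff_eq_add_scale by (intro add_mem scale_mem)

lemma ip_diff_right:
  assumes "F \<in> H" "G \<in> H" "K \<in> H"
  shows "ip F (G - K) = ip F G - ip F K"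
  using assms ip_scale_right[of F K "-1"] ip_add_right[of F G "\<lambda>i j. -1 * K i j"] scale_mem[of K "-1"]
  unfolding diff_eq_add_scale by simp

lemma ip_add_left:
  assumes "F \<in> H" "G \<in> H" "K \<in> H"
  shows "ip (F + G) K = ip F K + ip G K"
  using assms by (metis add_mem complex_cnj_add ip_add_right ip_cnj)

lemma ip_diff_left:
  assumes "F \<in> H" "G \<in> H" "K \<in> H"
  shows "ip (F - G) K = ip F K - ip G K"
  using assms by (metis diff_mem complex_cnj_diff ip_diff_right ip_cnj)

lemma hnorm_power2: "F \<in> H \<Longrightarrow> (hnorm ip F)\<^sup>2 = Re (ip F F)"
  by (simp add: hnorm_def ip_nonneg)

lemma hnorm_nonneg: "0 \<le> hnorm ip F" if "F \<in> H"
  using that by (simp add: hnorm_def ip_nonneg)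

text \<open>
  The parallelogram law yields this quantitative substitute for the triangle inequality, which is
  all that uniqueness of limits requires.
\<close>

lemma hnorm_diff_power2_le:
  assumes "F \<in> H" "G \<in> H"
  shows "(hnorm ip (F - G))\<^sup>2 \<le> 2 * (hnorm ip F)\<^sup>2 + 2 * (hnorm ip G)\<^sup>2"
proof -
  have "(hnorm ip (F + G))\<^sup>2 + (hnorm ip (F - G))\<^sup>2 = 2 * (hnorm ip F)\<^sup>2 + 2 * (hnorm ip G)\<^sup>2"
    using assms
    by (simp add: hnorm_power2 add_mem diff_mem ip_add_left ip_add_right ip_diff_left ip_diff_right)
  then show ?thesis
    by (smt (verit) zero_le_power2)
qed

lemma limit_unique:
  assumes "\<And>k. f k \<in> H" "u \<in> H" "v \<in> H"
    and "(\<lambda>k. hnorm ip (f k - u)) \<longlonglongrightarrow> 0" and "(\<lambda>k. hnorm ip (f k - v)) \<longlonglongrightarrow> 0"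
  shows "u = v"
proof -
  have "(\<lambda>k. 2 * (hnorm ip (f k - v))\<^sup>2 + 2 * (hnorm ip (f k - u))\<^sup>2) \<longlonglongrightarrow> 2 * 0\<^sup>2 + 2 * 0\<^sup>2"
    by (intro tendsto_intros assms)
  moreover have "(hnorm ip (u - v))\<^sup>2 \<le> 2 * (hnorm ip (f k - v))\<^sup>2 + 2 * (hnorm ip (f k - u))\<^sup>2" for k
    using hnorm_diff_power2_le[of "f k - v" "f k - u"] assms by (simp add: diff_mem)
  ultimately have "(hnorm ip (u - v))\<^sup>2 \<le> 0"
    by (intro LIMSEQ_le_const[where X = "\<lambda>k. 2 * (hnorm ip (f k - v))\<^sup>2 + 2 * (hnorm ip (f k - u))\<^sup>2"])
       (auto simp: power2_eq_square)
  then have "Re (ip (u - v) (u - v)) = 0"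
    using assms by (simp add: hnorm_power2[OF diff_mem, symmetric] antisym)
  then have "u - v = 0"
    using assms by (intro ip_definite diff_mem)
  then show ?thesis by simp
qed

text \<open>
  Boundedness identifies the closure of the graph of \<open>T\<close> over the dense subspace \<open>A\<close> with the graph
  of \<open>T\<close> over \<open>H\<close>. If \<open>(u, v)\<close> belongs to the adjoint of that graph, symmetry makes \<open>T u - v\<close>
  orthogonal to \<open>H\<close>, in particular to itself, so \<open>v = T u\<close>.
\<close>

theorem bounded_symmetric_essentially_self_adjoint:
  assumes maps: "\<And>F. F \<in> H \<Longrightarrow> T F \<in> H"
    and T_add: "\<And>F G. \<lbrakk>F \<in> H; G \<in> H\<rbrakk> \<Longrightarrow> T (F + G) = T F + T G"
    and T_scale: "\<And>c F. F \<in> H \<Longrightarrow> T (\<lambda>i j. c * F i j) = (\<lambda>i j. c * T F i j)"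
    and symmetric: "\<And>F G. \<lbrakk>F \<in> H; G \<in> H\<rbrakk> \<Longrightarrow> ip F (T G) = ip (T F) G"
    and bounded: "\<And>F. F \<in> H \<Longrightarrow> Re (ip (T F) (T F)) \<le> C * Re (ip F F)"
    and "A \<subseteq> H" "0 \<in> A"
    and A_add: "\<And>F G. \<lbrakk>F \<in> A; G \<in> A\<rbrakk> \<Longrightarrow> F + G \<in> A"
    and A_scale: "\<And>c F. F \<in> A \<Longrightarrow> (\<lambda>i j. c * F i j) \<in> A"
    and dense: "dense_in H ip A"
  shows "essentially_self_adjoint H ip A T"
proof -
  have T_diff: "T (F - G) = T F - T G" if "F \<in> H" "G \<in> H" for F G
    using that T_add[of F "\<lambda>i j. -1 * G i j"] T_scale[of G "-1"] scale_mem[of G "-1"]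
    unfolding diff_eq_add_scale by simp
  have hnorm_T: "hnorm ip (T F) \<le> sqrt C * hnorm ip F" if "F \<in> H" for F
    unfolding hnorm_def real_sqrt_mult[symmetric] by (rule real_sqrt_le_mono[OF bounded[OF that]])
  have T_limit: "(\<lambda>k. hnorm ip (T (f k) - T u)) \<longlonglongrightarrow> 0"
    if "\<And>k. f k \<in> H" "u \<in> H" "(\<lambda>k. hnorm ip (f k - u)) \<longlonglongrightarrow> 0" for f :: "nat \<Rightarrow> _" and u
  proof (rule tendsto_sandwich[of "\<lambda>_. 0" _ _ "\<lambda>k. sqrt C * hnorm ip (f k - u)"])
    show "(\<lambda>k. sqrt C * hnorm ip (f k - u)) \<longlonglongrightarrow> 0"
      using tendsto_mult_left[OF that(3), of "sqrt C"] by simp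
    show "\<forall>\<^sub>F k in sequentially. 0 \<le> hnorm ip (T (f k) - T u)"
      using that maps by (simp add: hnorm_nonneg diff_mem)
    show "\<forall>\<^sub>F k in sequentially. hnorm ip (T (f k) - T u) \<le> sqrt C * hnorm ip (f k - u)"
      using that hnorm_T by (simp add: T_diff[symmetric] diff_mem)
  qed simp
  have closure: "closure_graph H ip (graph_on A T) = graph_on H T"
  proof (intro set_eqI iffI)
    fix p assume "p \<in> closure_graph H ip (graph_on A T)"
    then obtain u v f g where p: "p = (u, v)" "u \<in> H" "v \<in> H"
      and fg: "\<And>k::nat. (f k, g k) \<in> graph_on A T"
      and f: "(\<lambda>k. hnorm ip (f k - u)) \<longlonglongrightarrow> 0" and g: "(\<lambda>k. hnorm ip (g k - v)) \<longlonglongrightarrow> 0"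
      unfolding closure_graph_def by auto
    have fA: "f k \<in> H" and g_eq: "g k = T (f k)" for k
      using fg[of k] \<open>A \<subseteq> H\<close> by (auto simp: graph_on_def)
    have "v = T u"
      using limit_unique[of g v "T u"] T_limit[OF fA p(2) f] g p fA maps by (simp add: g_eq)
    with p show "p \<in> graph_on H T"
      by (simp add: graph_on_def)
  next
    fix p assume "p \<in> graph_on H T"
    then obtain u where p: "p = (u, T u)" "u \<in> H"
      by (auto simp: graph_on_def)
    have "\<exists>f\<in>A. hnorm ip (f - u) < inverse (real (Suc k))" for k
      using dense p(2) unfolding dense_in_def by auto
    then obtain f where fA: "\<And>k. f k \<in> A" and f: "\<And>k. hnorm ip (f k - u) < inverse (real (Suc k))"
      by metis
    have fH: "f k \<in> H" for k
      using fA \<open>A \<subseteq> H\<close> by auto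
    have lim: "(\<lambda>k. hnorm ip (f k - u)) \<longlonglongrightarrow> 0"
    proof (rule tendsto_sandwich[OF _ _ tendsto_const LIMSEQ_inverse_real_of_nat])
      show "\<forall>\<^sub>F k in sequentially. 0 \<le> hnorm ip (f k - u)"
        using fH p(2) by (simp add: hnorm_nonneg diff_mem)
      show "\<forall>\<^sub>F k in sequentially. hnorm ip (f k - u) \<le> inverse (real (Suc k))"
        using f by (intro always_eventually allI less_imp_le)
    qed
    show "p \<in> closure_graph H ip (graph_on A T)"
      unfolding closure_graph_def p(1) mem_Collect_eq prod.case
    proof (intro conjI exI allI)
      show "(f k, T (f k)) \<in> graph_on A T" for k
        using fA by (simp add: graph_on_def)
    qed (use p(2) maps lim T_limit[OF fH p(2) lim] in auto)
  qed
  have adjoint: "adjoint_graph H ip (graph_on H T) = graph_on H T"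
  proof (intro set_eqI iffI)
    fix p assume "p \<in> adjoint_graph H ip (graph_on H T)"
    then obtain u v where p: "p = (u, v)" "u \<in> H" "v \<in> H"
      and adj: "\<And>f. f \<in> H \<Longrightarrow> ip u (T f) = ip v f"
      by (auto simp: adjoint_graph_def graph_on_def)
    have "T u - v \<in> H"
      using p maps by (simp add: diff_mem)
    moreover from this have "ip (T u - v) (T u - v) = 0"
      using p adj[of "T u - v"] symmetric[of u "T u - v"] maps
      by (simp add: ip_diff_left[of "T u" v "T u - v"])
    ultimately have "T u - v = 0"
      by (intro ip_definite) auto
    then have "v = T u" by simp
    with p show "p \<in> graph_on H T"
      by (simp add: graph_on_def)
  next
    fix p assume "p \<in> graph_on H T"
    then show "p \<in> adjoint_graph H ip (graph_on H T)"
      using maps symmetric by (auto simp: adjoint_graph_def graph_on_def)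
  qed
  have "linear_operator_on A T"
    unfolding linear_operator_on_def
    using \<open>0 \<in> A\<close> A_add A_scale T_add T_scale subsetD[OF \<open>A \<subseteq> H\<close>]
    by (intro conjI ballI allI) auto
  then show ?thesis
    unfolding essentially_self_adjoint_def closure adjoint
    using \<open>A \<subseteq> H\<close> maps dense by auto
qed

end

section \<open>Permutations of tuples\<close>

lemma length_remove_nth: "j < length xs \<Longrightarrow> length (remove_nth j xs) = length xs - 1"
  by (simp add: remove_nth_def)

lemma nth_remove_nth:
  assumes "j < length xs" "k < length xs - 1"
  shows "remove_nth j xs ! k = xs ! (if k < j then k else Suc k)"
  using assms by (auto simp: remove_nth_def nth_append)

text \<open>The simplicial identity behind \<open>d\<^sup>2 = 0\<close>.\<close>

lemma remove_nth_remove_nth: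
  assumes "k < j" "j < length xs"
  shows "remove_nth k (remove_nth j xs) = remove_nth (j - 1) (remove_nth k xs)"
  by (rule nth_equalityI) (use assms in \<open>auto simp: nth_remove_nth length_remove_nth\<close>)

lemma set_remove_nth_subset: "set (remove_nth j xs) \<subseteq> set xs"
  by (auto simp: remove_nth_def dest: in_set_takeD in_set_dropD)

abbreviation adjacent_swap :: "nat \<Rightarrow> nat \<Rightarrow> nat" where
  "adjacent_swap k \<equiv> Transposition.transpose k (Suc k)"

lemma adjacent_swap_permutes: "Suc k < N \<Longrightarrow> adjacent_swap k permutes {..<N}"
  by (simp add: permutes_swap_id)

text \<open>
  Adjacent transpositions generate the symmetric group. They interact with the removal of an entry
  in a simple way, so the alternating property of \<open>df\<close> is best checked on them.
\<close>

lemma permutes_adjacent_swap_induct [consumes 1, case_names id compose swap]: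
  assumes "p permutes {..<N::nat}"
    and id: "P id"
    and compose: "\<And>p q. \<lbrakk>p permutes {..<N}; q permutes {..<N}; P p; P q\<rbrakk> \<Longrightarrow> P (p \<circ> q)"
    and swap: "\<And>k. Suc k < N \<Longrightarrow> P (adjacent_swap k)"
  shows "P p"
proof -
  have up: "P (Transposition.transpose a (a + Suc l))" if "a + Suc l < N" for a l
    using that
  proof (induction l)
    case 0
    then show ?case using swap by simp
  next
    case (Suc l)
    define s t where "s = adjacent_swap (a + Suc l)" and "t = Transposition.transpose a (a + Suc l)"
    have perms: "s permutes {..<N}" "t permutes {..<N}"
      using Suc.prems by (auto simp: s_def t_def intro!: permutes_swap_id)
    \<comment> \<open>A longer transposition is the conjugate of a shorter one by an adjacent one.\<close>
    have eq: "Transposition.transpose a (a + Suc (Suc l)) = s \<circ> (t \<circ> s)"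
      by (auto simp: fun_eq_iff s_def t_def Transposition.transpose_def)
    show ?case
      unfolding eq using Suc perms swap[of "a + Suc l"]
      by (intro compose permutes_compose) (auto simp: s_def t_def)
  qed
  have transposition: "P (Transposition.transpose a b)" if "a < N" "b < N" "a \<noteq> b" for a b
  proof (cases "a < b")
    case True
    then show ?thesis using up[of a "b - a - 1"] that by simp
  next
    case False
    then show ?thesis using up[of b "a - b - 1"] that by (simp add: transpose_commute)
  qed
  show ?thesis
  proof (rule permutes_induct[of p, OF assms(1) finite_lessThan, where P = P, OF id])
    fix a b p
    assume ab: "a \<in> {..<N}" "b \<in> {..<N}" "a \<noteq> b" and p: "P p" "p permutes {..<N}"
    have "P (Transposition.transpose a b)"
      using ab by (intro transposition) auto
    with ab p show "P (Transposition.transpose a b \<circ> p)"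
      by (intro compose permutes_swap_id)
  qed
qed

lemma sign_compose_permutes:
  assumes "p permutes {..<N::nat}" "q permutes {..<N}"
  shows "sign (p \<circ> q) = sign p * sign q"
  using assms by (intro sign_compose) (auto simp: permutation_permutes)

text \<open>
  Carrying entry \<open>j\<close> to the end passes it across the \<open>N - 1 - j\<close> entries behind it, which accounts
  for the sign. The permutation depends on \<open>j\<close> and \<open>N\<close> only, so it acts on all simplices of one
  dimension at once and can be used to reindex sums over them.
\<close>

lemma remove_nth_append_eq_permute_list:
  assumes "j < N"
  shows "\<exists>p. p permutes {..<N} \<and> sign p = (-1) ^ (N - 1 - j) \<and>
    (\<forall>xs :: 'a list. length xs = N \<longrightarrow> permute_list p xs = remove_nth j xs @ [xs ! j])"
proof -
  have "j \<le> N - 1" using assms by simp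
  then show ?thesis
  proof (induction j rule: inc_induct)
    case base
    have "remove_nth (N - 1) xs @ [xs ! (N - 1)] = xs" if "length xs = N" for xs :: "'a list"
      using that assms by (cases xs rule: rev_cases) (auto simp: remove_nth_def)
    then show ?case
      by (intro exI[of _ id] conjI) (simp_all add: permutes_id del: id_apply)
  next
    case (step k)
    then obtain p where p: "p permutes {..<N}" "sign p = (-1) ^ (N - 1 - Suc k)"
      and shift: "\<And>xs :: 'a list. length xs = N \<Longrightarrow> permute_list p xs = remove_nth (Suc k) xs @ [xs ! Suc k]"
      by auto
    have k: "Suc k < N" using step by simp
    define s where "s = adjacent_swap k"
    have s: "s permutes {..<N}" unfolding s_def using k by (rule adjacent_swap_permutes)
    have "permute_list (s \<circ> p) xs = remove_nth k xs @ [xs ! k]" if len: "length xs = N" for xs :: "'a list"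
    proof -
      have "permute_list (s \<circ> p) xs = permute_list p (permute_list s xs)"
        using p len by (simp add: permute_list_compose)
      also have "\<dots> = remove_nth (Suc k) (permute_list s xs) @ [permute_list s xs ! Suc k]"
        using len by (simp add: shift)
      also have "permute_list s xs ! Suc k = xs ! k"
        using k s len by (simp add: permute_list_nth s_def)
      also have "remove_nth (Suc k) (permute_list s xs) = remove_nth k xs"
        by (rule nth_equalityI)
           (use k s len in \<open>auto simp: length_remove_nth nth_remove_nth permute_list_nth s_def
              Transposition.transpose_def less_Suc_eq\<close>)
      finally show ?thesis .
    qed
    moreover have "sign (s \<circ> p) = (-1) ^ (N - 1 - k)"
    proof -
      have "N - 1 - k = Suc (N - 1 - Suc k)" using k by simp
      then show ?thesis
        using sign_compose_permutes[OF s p(1)] p(2) by (simp add: s_def sign_swap_id)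
    qed
    moreover have "s \<circ> p permutes {..<N}"
      using p(1) s by (rule permutes_compose)
    ultimately show ?case by blast
  qed
qed

text \<open>
  Removing an entry outside the swapped pair leaves an adjacent swap behind, shifted down by one
  when the removed entry stood in front of the pair.
\<close>

lemma remove_nth_adjacent_swap:
  assumes k: "Suc k < length xs" and j: "j < length xs" "j \<noteq> k" "j \<noteq> Suc k"
  shows "\<exists>k'. Suc k' < length (remove_nth j xs) \<and>
    remove_nth j (permute_list (adjacent_swap k) xs) = permute_list (adjacent_swap k') (remove_nth j xs)"
proof -
  define k' where "k' = (if j < k then k - 1 else k)"
  have k': "Suc k' < length (remove_nth j xs)"
    using assms by (auto simp: k'_def length_remove_nth)
  moreover have "remove_nth j (permute_list (adjacent_swap k) xs) = permute_list (adjacent_swap k') (remove_nth j xs)"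
    apply (rule nth_equalityI)
    subgoal using j by (simp add: length_remove_nth)
    subgoal for l
      using assms k' adjacent_swap_permutes[OF k] adjacent_swap_permutes[OF k']
      by (auto simp: length_remove_nth nth_remove_nth permute_list_nth k'_def Transposition.transpose_def
           permutes_in_image split: if_splits)
    done
  ultimately show ?thesis by blast
qed

lemma remove_nth_adjacent_swap_same:
  assumes "Suc k < length xs"
  shows "remove_nth k (permute_list (adjacent_swap k) xs) = remove_nth (Suc k) xs"
    and "remove_nth (Suc k) (permute_list (adjacent_swap k) xs) = remove_nth k xs"
  by (rule nth_equalityI; use assms adjacent_swap_permutes[OF assms] in \<open>auto simp: length_remove_nth
        nth_remove_nth permute_list_nth Transposition.transpose_def less_Suc_eq\<close>)+

section \<open>Simplices and alternating functions\<close>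

context weighted_complex
begin

lemma adjacent_sym:
  assumes "x \<in> V" "y \<in> V"
  shows "adjacent m x y \<longleftrightarrow> adjacent m y x"
proof -
  have "permute_list (adjacent_swap 0) [x, y] = [y, x]"
    by (simp add: permute_list_def upt_rec)
  moreover have "adjacent_swap 0 permutes {..<length [x, y]}"
    by (rule adjacent_swap_permutes) simp
  ultimately have "m 1 [y, x] = m 1 [x, y]"
    using weight_permute[of 1 "[x, y]" "adjacent_swap 0"] n_ge_2 assms by simp
  then show ?thesis by (simp add: adjacent_def)
qed

lemma simplicesD:
  assumes "xs \<in> simplices V m i"
  shows "length xs = Suc i" "set xs \<subseteq> V"
  using assms by (auto simp: simplices_def)

lemma remove_nth_simplex:
  assumes "xs \<in> simplices V m (Suc i)" "j \<le> Suc i"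
  shows "remove_nth j xs \<in> simplices V m i"
  using assms set_remove_nth_subset[of j xs]
  by (auto simp: simplices_def length_remove_nth nth_remove_nth)

lemma permute_list_simplex:
  assumes "xs \<in> simplices V m i" "p permutes {..<Suc i}"
  shows "permute_list p xs \<in> simplices V m i"
proof -
  have len: "length xs = Suc i" using assms simplicesD by auto
  have "p j \<noteq> p k" if "j \<noteq> k" for j k
    using that permutes_inj[OF assms(2)] by (auto simp: inj_def)
  moreover have "p j < Suc i" if "j < Suc i" for j
    using that permutes_in_image[OF assms(2)] by auto
  ultimately show ?thesis
    using assms len by (auto simp: simplices_def permute_list_nth)
qed

lemma permute_list_bij_simplices:
  assumes "p permutes {..<Suc i}"
  shows "bij_betw (permute_list p) (simplices V m i) (simplices V m i)"
proof (rule bij_betwI[where g = "permute_list (inv p)"])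
  have inv: "inv p permutes {..<Suc i}" using assms by (rule permutes_inv)
  show "permute_list p \<in> simplices V m i \<rightarrow> simplices V m i"
    and "permute_list (inv p) \<in> simplices V m i \<rightarrow> simplices V m i"
    using permute_list_simplex assms inv by auto
  fix xs assume "xs \<in> simplices V m i"
  then have len: "length xs = Suc i" by (rule simplicesD)
  have "permute_list (inv p) (permute_list p xs) = permute_list (p \<circ> inv p) xs"
    using inv len by (simp add: permute_list_compose)
  then show "permute_list (inv p) (permute_list p xs) = xs"
    using permutes_inv_o(1)[OF assms] by simp
  have "permute_list p (permute_list (inv p) xs) = permute_list (inv p \<circ> p) xs"
    using assms len by (simp add: permute_list_compose)
  then show "permute_list p (permute_list (inv p) xs) = xs"
    using permutes_inv_o(2)[OF assms] by simp
qed

lemma simplex_snoc_iff: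
  "xs @ [y] \<in> simplices V m (Suc i) \<longleftrightarrow> xs \<in> simplices V m i \<and> y \<in> common_neighbours V m xs"
  (is "?l \<longleftrightarrow> ?r")
proof
  assume ?l
  then have len: "length xs = Suc i" "set xs \<subseteq> V" "y \<in> V"
    and adj: "\<And>j k. \<lbrakk>j < Suc (Suc i); k < Suc (Suc i); j \<noteq> k\<rbrakk> \<Longrightarrow> adjacent m ((xs @ [y]) ! j) ((xs @ [y]) ! k)"
    by (auto simp: simplices_def)
  have "adjacent m (xs ! j) (xs ! k)" if "j < Suc i" "k < Suc i" "j \<noteq> k" for j k
    using adj[of j k] that len by (simp add: nth_append)
  moreover have "adjacent m (xs ! j) y" if "j < Suc i" for j
    using adj[of j "Suc i"] that len by (simp add: nth_append)
  ultimately show ?r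
    using len by (auto simp: simplices_def common_neighbours_def in_set_conv_nth)
next
  assume ?r
  then have r: "length xs = Suc i" "set xs \<subseteq> V" "y \<in> V"
    and adj: "\<And>j k. \<lbrakk>j < Suc i; k < Suc i; j \<noteq> k\<rbrakk> \<Longrightarrow> adjacent m (xs ! j) (xs ! k)"
    and y: "\<And>x. x \<in> set xs \<Longrightarrow> adjacent m x y"
    by (auto simp: simplices_def common_neighbours_def)
  have "adjacent m y x" if "x \<in> set xs" for x
    using adjacent_sym[of x y] r y that by auto
  then show ?l
    using r adj y by (auto simp: simplices_def nth_append less_Suc_eq)
qed

text \<open>
  Sums over \<open>(i + 1)\<close>-simplices become iterated sums, over the \<open>i\<close>-simplices and then over the
  vertices that extend them; this is how the weighted degrees enter.
\<close>

lemma simplices_Suc_bij: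
  "bij_betw (\<lambda>(xs, y). xs @ [y]) (Sigma (simplices V m i) (common_neighbours V m)) (simplices V m (Suc i))"
proof (rule bij_betwI[where g = "\<lambda>zs. (butlast zs, last zs)"])
  show "(\<lambda>zs. (butlast zs, last zs)) \<in> simplices V m (Suc i) \<rightarrow> Sigma (simplices V m i) (common_neighbours V m)"
  proof
    fix zs assume zs: "zs \<in> simplices V m (Suc i)"
    then have "zs \<noteq> []" using simplicesD(1) by fastforce
    then have "butlast zs @ [last zs] \<in> simplices V m (Suc i)" using zs by simp
    then show "(butlast zs, last zs) \<in> Sigma (simplices V m i) (common_neighbours V m)"
      by (auto simp only: simplex_snoc_iff)
  qed
  show "(\<lambda>(xs, y). xs @ [y]) (butlast zs, last zs) = zs" if "zs \<in> simplices V m (Suc i)" for zs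
    using simplicesD(1)[OF that] by (cases zs rule: rev_cases) auto
qed (auto simp: simplex_snoc_iff)

lemma simplex_weight_pos: "i < n \<Longrightarrow> xs \<in> simplices V m i \<Longrightarrow> 0 < m i xs"
  using weight_pos_iff[of i xs] by (auto simp: simplices_def)

lemma weight_permute_simplex:
  "\<lbrakk>i < n; xs \<in> simplices V m i; p permutes {..<Suc i}\<rbrakk> \<Longrightarrow> m i (permute_list p xs) = m i xs"
  using weight_permute[of i xs p] by (auto simp: simplices_def)

lemma common_neighbours_permute_list:
  "\<lbrakk>xs \<in> simplices V m i; p permutes {..<Suc i}\<rbrakk> \<Longrightarrow>
     common_neighbours V m (permute_list p xs) = common_neighbours V m xs"
  using simplicesD(1) by (fastforce simp: common_neighbours_def)

lemma alternating_permute_list: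
  "\<lbrakk>f \<in> alternating V m i; xs \<in> simplices V m i; p permutes {..<Suc i}\<rbrakk> \<Longrightarrow>
     f (permute_list p xs) = of_int (sign p) * f xs"
  using simplicesD(1) unfolding alternating_def by fastforce

lemma alternating_eq_0: "\<lbrakk>f \<in> alternating V m i; xs \<notin> simplices V m i\<rbrakk> \<Longrightarrow> f xs = 0"
  by (simp add: alternating_def)

lemma alternatingI:
  assumes "\<And>xs. xs \<notin> simplices V m i \<Longrightarrow> f xs = 0"
    and swap: "\<And>xs k. \<lbrakk>xs \<in> simplices V m i; k < i\<rbrakk> \<Longrightarrow> f (permute_list (adjacent_swap k) xs) = - f xs"
  shows "f \<in> alternating V m i"
proof -
  have "\<forall>xs \<in> simplices V m i. f (permute_list p xs) = of_int (sign p) * f xs"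
    if "p permutes {..<Suc i}" for p
    using that
  proof (induction rule: permutes_adjacent_swap_induct)
    case id
    then show ?case by simp
  next
    case (compose p q)
    show ?case
    proof
      fix xs assume xs: "xs \<in> simplices V m i"
      then have "permute_list (p \<circ> q) xs = permute_list q (permute_list p xs)"
        using compose.hyps simplicesD(1) by (intro permute_list_compose) auto
      then show "f (permute_list (p \<circ> q) xs) = of_int (sign (p \<circ> q)) * f xs"
        using compose xs by (simp only: permute_list_simplex sign_compose_permutes of_int_mult ac_simps)
    qed
  next
    case (swap k)
    then show ?case using assms(2) by (simp add: sign_swap_id)
  qed
  then show ?thesis
    using assms(1) simplicesD(1) by (auto simp: alternating_def)
qed

text \<open>
  Under the swap of the vertices \<open>k\<close> and \<open>k + 1\<close>, the faces opposite to these two vertices are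
  exchanged while their signs in \<open>df\<close> are opposite, and every other face undergoes an adjacent swap
  itself, which changes the sign of \<open>f\<close>.
\<close>

lemma coboundary_alternating:
  assumes f: "f \<in> alternating V m i"
  shows "coboundary V m i f \<in> alternating V m (Suc i)"
proof (rule alternatingI)
  fix xs k assume xs: "xs \<in> simplices V m (Suc i)" and k: "k < Suc i"
  let ?s = "adjacent_swap k" and ?ys = "permute_list (adjacent_swap k) xs"
  have len: "length xs = Suc (Suc i)" using xs by (rule simplicesD)
  have perm: "?s permutes {..<Suc (Suc i)}" using k by (intro adjacent_swap_permutes) simp
  have ys: "?ys \<in> simplices V m (Suc i)" using xs perm by (rule permute_list_simplex)
  have face: "(-1) ^ ?s j * f (remove_nth (?s j) ?ys) = - ((-1) ^ j * f (remove_nth j xs))"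
    if j: "j \<le> Suc i" for j
  proof -
    consider "j = k" | "j = Suc k" | "j \<noteq> k" "j \<noteq> Suc k" by blast
    then show ?thesis
    proof cases
      case 3
      obtain k' where k': "Suc k' < length (remove_nth j xs)"
        and eq: "remove_nth j ?ys = permute_list (adjacent_swap k') (remove_nth j xs)"
        using remove_nth_adjacent_swap[of k xs j] k j len 3 by auto
      have "f (remove_nth j ?ys) = - f (remove_nth j xs)"
        using alternating_permute_list[OF f remove_nth_simplex[OF xs j], of "adjacent_swap k'"] k' j len
        by (simp add: eq sign_swap_id adjacent_swap_permutes length_remove_nth)
      then show ?thesis using 3 by simp
    qed (use k len in \<open>simp_all add: remove_nth_adjacent_swap_same\<close>)
  qed
  have "coboundary V m i f ?ys = (\<Sum>j\<le>Suc i. (-1) ^ j * f (remove_nth j ?ys))"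
    using ys by (simp add: coboundary_def)
  also have "\<dots> = (\<Sum>j\<le>Suc i. (-1) ^ ?s j * f (remove_nth (?s j) ?ys))"
    using perm by (intro sum.reindex_bij_betw[symmetric])
      (simp add: lessThan_Suc_atMost permutes_imp_bij)
  also have "\<dots> = (\<Sum>j\<le>Suc i. - ((-1) ^ j * f (remove_nth j xs)))"
    using face by (intro sum.cong refl) auto
  also have "\<dots> = - coboundary V m i f xs"
    using xs by (simp add: coboundary_def sum_negf del: sum.atMost_Suc)
  finally show "coboundary V m i f ?ys = - coboundary V m i f xs" .
qed (simp add: coboundary_def)

text \<open>
  A permutation of \<open>xs\<close> extends to \<open>xs @ [y]\<close> by fixing the last place, with the same sign.
\<close>

lemma codifferential_alternating:
  assumes i: "Suc i < n" and g: "g \<in> alternating V m (Suc i)"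
  shows "codifferential V m (Suc i) g \<in> alternating V m i"
proof -
  have "codifferential V m (Suc i) g (permute_list p xs) = of_int (sign p) * codifferential V m (Suc i) g xs"
    if xs: "xs \<in> simplices V m i" and p: "p permutes {..<Suc i}" for xs p
  proof -
    have p': "p permutes {..<Suc (Suc i)}"
      using p by (rule permutes_subset) auto
    have snoc: "permute_list p xs @ [y] = permute_list p (xs @ [y])" for y
    proof -
      have "p (Suc i) = Suc i"
        using p by (auto simp: permutes_def)
      moreover have "p j < Suc i" if "j < Suc i" for j
        using that permutes_in_image[OF p] by auto
      ultimately show ?thesis
        using simplicesD(1)[OF xs] p
        by (auto simp: permute_list_def nth_append)
    qed
    have "(\<Sum>y\<in>common_neighbours V m xs. of_real (m (Suc i) (permute_list p xs @ [y])) * g (permute_list p xs @ [y]))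
        = (\<Sum>y\<in>common_neighbours V m xs. of_int (sign p) * (of_real (m (Suc i) (xs @ [y])) * g (xs @ [y])))"
      using xs i p' by (intro sum.cong refl)
        (simp add: snoc simplex_snoc_iff weight_permute_simplex alternating_permute_list[OF g])
    then show ?thesis
      using xs p i permute_list_simplex[OF xs p] weight_permute_simplex[of i xs p]
      by (simp add: codifferential_def common_neighbours_permute_list sum_distrib_left[symmetric])
  qed
  then show ?thesis
    using simplicesD(1) by (auto simp: alternating_def codifferential_def)
qed

lemma coboundary_add: "coboundary V m i (f + g) = coboundary V m i f + coboundary V m i g"
  by (auto simp: coboundary_def fun_eq_iff algebra_simps sum.distrib simp del: sum.atMost_Suc)

lemma codifferential_add: "codifferential V m i (f + g) = codifferential V m i f + codifferential V m i g"
  by (auto simp: codifferential_def fun_eq_iff algebra_simps sum.distrib)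

lemma coboundary_scale: "coboundary V m i (\<lambda>xs. c * f xs) = (\<lambda>xs. c * coboundary V m i f xs)"
  by (auto simp: coboundary_def fun_eq_iff sum_distrib_left ac_simps simp del: sum.atMost_Suc)

lemma codifferential_scale: "codifferential V m i (\<lambda>xs. c * f xs) = (\<lambda>xs. c * codifferential V m i f xs)"
  by (auto simp: codifferential_def fun_eq_iff sum_distrib_left ac_simps)

lemma coboundary_0: "coboundary V m i 0 = 0"
  by (auto simp: coboundary_def fun_eq_iff)

lemma codifferential_0: "codifferential V m i 0 = 0"
  by (auto simp: codifferential_def fun_eq_iff)

text \<open>
  The double sum over pairs of removed vertices splits into the pairs with \<open>k < j\<close> and those with
  \<open>j \<le> k\<close>; the simplicial identity matches \<open>(j, k)\<close> with \<open>(k, j - 1)\<close>, whose sign is opposite.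
\<close>

lemma coboundary_coboundary: "coboundary V m (Suc i) (coboundary V m i f) = 0"
proof
  fix xs
  show "coboundary V m (Suc i) (coboundary V m i f) xs = 0 xs"
  proof (cases "xs \<in> simplices V m (Suc (Suc i))")
    case True
    then have len: "length xs = Suc (Suc (Suc i))" by (rule simplicesD)
    define t where "t = (\<lambda>(j, k). (-1) ^ (j + k) * f (remove_nth k (remove_nth j xs)))"
    define lower where "lower = {(j, k). j \<le> Suc (Suc i) \<and> k < j}"
    define upper where "upper = {(j, k). j \<le> k \<and> k \<le> Suc i}"
    have fin: "finite lower" "finite upper"
      by (rule finite_subset[of _ "{..Suc (Suc i)} \<times> {..Suc (Suc i)}"]; auto simp: lower_def upper_def)+
    have cancel: "sum t upper = (\<Sum>p\<in>lower. - t p)"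
    proof (rule sum.reindex_bij_witness[where i = "\<lambda>(j, k). (k, j - 1)" and j = "\<lambda>(j, k). (Suc k, j)"])
      fix p assume "p \<in> upper"
      then obtain j k where p: "p = (j, k)" "j \<le> k" "k \<le> Suc i"
        by (auto simp: upper_def)
      have "remove_nth j (remove_nth (Suc k) xs) = remove_nth k (remove_nth j xs)"
        using remove_nth_remove_nth[of j "Suc k" xs] p len by simp
      then show "- t (case p of (j, k) \<Rightarrow> (Suc k, j)) = t p"
        by (simp add: t_def p add.commute)
    qed (auto simp: upper_def lower_def)
    have "coboundary V m (Suc i) (coboundary V m i f) xs
      = (\<Sum>j\<le>Suc (Suc i). (-1) ^ j * (\<Sum>k\<le>Suc i. (-1) ^ k * f (remove_nth k (remove_nth j xs))))"
      using True by (simp add: coboundary_def remove_nth_simplex del: sum.atMost_Suc)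
    also have "\<dots> = sum t ({..Suc (Suc i)} \<times> {..Suc i})"
      by (simp add: sum.cartesian_product[symmetric] t_def sum_distrib_left power_add ac_simps
          del: sum.atMost_Suc)
    also have "{..Suc (Suc i)} \<times> {..Suc i} = lower \<union> upper"
      by (auto simp: lower_def upper_def)
    also have "sum t \<dots> = sum t lower + sum t upper"
      using fin by (intro sum.union_disjoint) (auto simp: lower_def upper_def)
    also have "\<dots> = 0"
      by (simp add: cancel sum_negf)
    finally show ?thesis by simp
  qed (simp add: coboundary_def)
qed

end

locale locally_finite_complex = weighted_complex V n m
  for V :: "'v set" and n :: nat and m :: "'v weights" +
  assumes locally_finite: "locally_finite V m"
begin

lemma finite_common_neighbours: "xs \<in> simplices V m i \<Longrightarrow> finite (common_neighbours V m xs)"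
proof -
  assume xs: "xs \<in> simplices V m i"
  then have "hd xs \<in> set xs" "hd xs \<in> V"
    using simplicesD[OF xs] by (cases xs; auto)+
  moreover from this have "common_neighbours V m xs \<subseteq> {y \<in> V. adjacent m (hd xs) y}"
    by (auto simp: common_neighbours_def)
  ultimately show ?thesis
    using locally_finite unfolding locally_finite_def by (meson finite_subset)
qed

text \<open>
  Up to the weight of \<open>xs\<close>, applying \<open>\<delta>\<close> twice sums \<open>m g\<close> over all pairs of vertices that extend
  \<open>xs\<close>, and exchanging the two vertices reverses the sign of each term.
\<close>

lemma codifferential_codifferential:
  assumes i: "Suc (Suc i) < n" and g: "g \<in> alternating V m (Suc (Suc i))"
  shows "codifferential V m (Suc i) (codifferential V m (Suc (Suc i)) g) = 0"
proof
  fix xs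
  show "codifferential V m (Suc i) (codifferential V m (Suc (Suc i)) g) xs = 0 xs"
  proof (cases "xs \<in> simplices V m i")
    case True
    let ?N = "common_neighbours V m"
    let ?t = "\<lambda>(y, z). of_real (m (Suc (Suc i)) (xs @ [y, z])) * g (xs @ [y, z])"
    let ?P = "Sigma (?N xs) (\<lambda>y. ?N (xs @ [y]))"
    have len: "length xs = Suc i" using True by (rule simplicesD)
    have P_iff: "(y, z) \<in> ?P \<longleftrightarrow> xs @ [y, z] \<in> simplices V m (Suc (Suc i))" for y z
      using simplex_snoc_iff[of "xs @ [y]" z "Suc i"] simplex_snoc_iff[of xs y i] True by auto
    have swap: "permute_list (adjacent_swap (Suc i)) (xs @ [y, z]) = xs @ [z, y]" for y z
      using len adjacent_swap_permutes[of "Suc i" "length (xs @ [y, z])"]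
      by (intro nth_equalityI) (auto simp: permute_list_nth nth_append Transposition.transpose_def nth_Cons' not_less_eq less_Suc_eq)
    have perm: "adjacent_swap (Suc i) permutes {..<Suc (Suc (Suc i))}"
      by (rule adjacent_swap_permutes) simp
    have swap_mem: "xs @ [z, y] \<in> simplices V m (Suc (Suc i))" if "xs @ [y, z] \<in> simplices V m (Suc (Suc i))" for y z
      using permute_list_simplex[OF that perm] by (simp add: swap)
    have anti: "?t (z, y) = - ?t (y, z)" if "xs @ [y, z] \<in> simplices V m (Suc (Suc i))" for y z
      using weight_permute_simplex[OF i that perm] alternating_permute_list[OF g that perm]
      by (simp add: swap sign_swap_id)
    have "sum ?t ?P = (\<Sum>p\<in>?P. - ?t p)"
    proof (rule sum.reindex_bij_witness[where i = prod.swap and j = prod.swap])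
      fix p assume p: "p \<in> ?P"
      then obtain y z where yz: "p = (y, z)" "xs @ [y, z] \<in> simplices V m (Suc (Suc i))"
        by (cases p) (simp only: P_iff)
      have "(z, y) \<in> ?P"
        unfolding P_iff by (rule swap_mem[OF yz(2)])
      then show "prod.swap p \<in> ?P" "prod.swap p \<in> ?P"
        by (simp_all only: yz(1) swap_simp)
      show "- ?t (prod.swap p) = ?t p"
        using anti[OF yz(2)] by (simp only: yz(1) swap_simp minus_minus)
    qed simp_all
    then have zero: "sum ?t ?P = 0"
      by (simp add: sum_negf eq_neg_iff_add_eq_0)
    have "(\<Sum>y\<in>?N xs. of_real (m (Suc i) (xs @ [y])) * codifferential V m (Suc (Suc i)) g (xs @ [y]))
      = (\<Sum>y\<in>?N xs. (-1) ^ Suc (Suc i) * (\<Sum>z\<in>?N (xs @ [y]). ?t (y, z)))"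
    proof (intro sum.cong refl)
      fix y assume "y \<in> ?N xs"
      then have "xs @ [y] \<in> simplices V m (Suc i)"
        using True by (simp add: simplex_snoc_iff)
      moreover from this have "m (Suc i) (xs @ [y]) > 0"
        using i by (intro simplex_weight_pos) auto
      ultimately show "of_real (m (Suc i) (xs @ [y])) * codifferential V m (Suc (Suc i)) g (xs @ [y])
          = (-1) ^ Suc (Suc i) * (\<Sum>z\<in>?N (xs @ [y]). ?t (y, z))"
        by (simp add: codifferential_def)
    qed
    also have "\<dots> = (-1) ^ Suc (Suc i) * sum ?t ?P"
      using True
      by (simp only: sum_distrib_left[symmetric])
         (subst sum.Sigma, auto simp: finite_common_neighbours
            intro!: finite_common_neighbours[of _ "Suc i"] simp: simplex_snoc_iff)
    finally show ?thesis
      by (simp add: zero codifferential_def)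
  qed (simp add: codifferential_def)
qed

text \<open>
  The parts of \<open>DF\<close> that cross two degrees vanish, by \<open>d\<^sup>2 = 0\<close> and \<open>\<delta>\<^sup>2 = 0\<close>. What is left in degree
  \<open>i\<close> involves \<open>F i\<close> only.
\<close>

lemma hodge_laplacian_eq_hodge_block:
  assumes F: "\<And>i. i < n \<Longrightarrow> F i \<in> alternating V m i" and i: "i < n"
  shows "hodge_laplacian V n m F i = hodge_block V n m i (F i)"
proof -
  let ?D = "gauss_bonnet V n m"
  have lower: "coboundary V m (i - 1) (?D F (i - 1)) = coboundary V m (i - 1) (codifferential V m i (F i))"
    if "1 \<le> i"
  proof -
    let ?up = "if 1 \<le> i - 1 \<and> i - 1 < n then coboundary V m (i - 1 - 1) (F (i - 1 - 1)) else 0"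
    have "coboundary V m (i - 1) ?up = 0"
    proof (cases "2 \<le> i")
      case True
      then obtain k where "i = Suc (Suc k)" by (metis add_2_eq_Suc le_Suc_ex)
      then show ?thesis by (simp add: coboundary_coboundary coboundary_0)
    qed (simp add: coboundary_0)
    moreover have "?D F (i - 1) = ?up + codifferential V m i (F i)"
      using that i by (simp add: gauss_bonnet_def)
    ultimately show ?thesis by (simp only: coboundary_add add_0)
  qed
  have upper: "codifferential V m (i + 1) (?D F (i + 1)) = codifferential V m (i + 1) (coboundary V m i (F i))"
    if "i + 1 < n"
  proof -
    let ?down = "if i + 1 + 1 < n then codifferential V m (i + 1 + 1) (F (i + 1 + 1)) else 0"
    have "codifferential V m (i + 1) ?down = 0"
      using codifferential_codifferential[of i "F (i + 1 + 1)"] F[of "i + 1 + 1"]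
      by (simp add: codifferential_0)
    moreover have "?D F (i + 1) = coboundary V m i (F i) + ?down"
      using that by (simp add: gauss_bonnet_def)
    ultimately show ?thesis by (simp only: codifferential_add add_0_right)
  qed
  show ?thesis
    using lower upper i unfolding hodge_laplacian_def hodge_block_def gauss_bonnet_def[of V n m "?D F"]
    by simp
qed

end

section \<open>Square-summable cochains\<close>

lemma has_sum_sum_index:
  fixes f :: "'i \<Rightarrow> 'a \<Rightarrow> 'b :: topological_comm_monoid_add"
  assumes "\<And>j. j \<in> J \<Longrightarrow> (f j has_sum s j) S"
  shows "((\<lambda>x. \<Sum>j\<in>J. f j x) has_sum (\<Sum>j\<in>J. s j)) S"
  using assms by (induction J rule: infinite_finite_induct) (auto intro!: has_sum_add)

lemma weighted_square_add_le:
  fixes a b :: complex and w :: real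
  assumes "0 \<le> w"
  shows "w * (cmod (a + b))\<^sup>2 \<le> 2 * (w * (cmod a)\<^sup>2) + 2 * (w * (cmod b)\<^sup>2)"
proof -
  have "(cmod (a + b))\<^sup>2 \<le> (cmod a + cmod b)\<^sup>2"
    by (intro power_mono norm_triangle_ineq) auto
  also have "\<dots> \<le> 2 * (cmod a)\<^sup>2 + 2 * (cmod b)\<^sup>2"
    using zero_le_power2[of "cmod a - cmod b"] by (simp add: power2_eq_square algebra_simps)
  finally show ?thesis
    using mult_left_mono[OF _ assms] by (fastforce simp: algebra_simps)
qed

lemma weighted_product_summable:
  fixes f g :: "'a \<Rightarrow> complex" and w :: "'a \<Rightarrow> real"
  assumes w: "\<And>x. x \<in> S \<Longrightarrow> 0 \<le> w x"
    and f: "(\<lambda>x. w x * (cmod (f x))\<^sup>2) summable_on S"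
    and g: "(\<lambda>x. w x * (cmod (g x))\<^sup>2) summable_on S"
  shows "(\<lambda>x. of_real (w x) * cnj (f x) * g x) summable_on S"
proof -
  have "(\<lambda>x. cmod (of_real (w x) * cnj (f x) * g x)) summable_on S"
  proof (rule Infinite_Sum.abs_summable_on_comparison_test')
    show "(\<lambda>x. w x * (cmod (f x))\<^sup>2 + w x * (cmod (g x))\<^sup>2) summable_on S"
      using f g by (rule summable_on_add)
    fix x assume "x \<in> S"
    have "cmod (f x) * cmod (g x) \<le> (cmod (f x))\<^sup>2 + (cmod (g x))\<^sup>2"
      using zero_le_power2[of "cmod (f x) - cmod (g x)"] zero_le_power2[of "cmod (f x)"]
        zero_le_power2[of "cmod (g x)"]
      by (simp only: power2_diff)
    from mult_left_mono[OF this w[OF \<open>x \<in> S\<close>]]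
    show "cmod (of_real (w x) * cnj (f x) * g x) \<le> w x * (cmod (f x))\<^sup>2 + w x * (cmod (g x))\<^sup>2"
      using w[OF \<open>x \<in> S\<close>] by (simp add: norm_mult algebra_simps)
  qed
  then show ?thesis by (rule abs_summable_summable)
qed

context weighted_complex
begin

text \<open>
  Every unoriented simplex is counted once for each of its orderings, so this is the square of the
  norm of \<open>inner_l2\<close> up to the factor \<open>(i + 1)!\<close>.
\<close>

definition sqnorm :: "nat \<Rightarrow> ('v list \<Rightarrow> complex) \<Rightarrow> real" where
  "sqnorm i f = (\<Sum>\<^sub>\<infinity>xs\<in>simplices V m i. m i xs * (cmod (f xs))\<^sup>2)"

lemma alternating_add: "\<lbrakk>f \<in> alternating V m i; g \<in> alternating V m i\<rbrakk> \<Longrightarrow> f + g \<in> alternating V m i"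
  by (simp add: alternating_def algebra_simps)

lemma alternating_scale: "f \<in> alternating V m i \<Longrightarrow> (\<lambda>xs. c * f xs) \<in> alternating V m i"
  by (simp add: alternating_def algebra_simps)

lemma alternating_0: "0 \<in> alternating V m i"
  by (simp add: alternating_def)

lemma l2_has_sum:
  "f \<in> l2 V m i \<Longrightarrow> ((\<lambda>xs. m i xs * (cmod (f xs))\<^sup>2) has_sum sqnorm i f) (simplices V m i)"
  unfolding l2_def sqnorm_def by (auto intro: has_sum_infsum)

lemma weight_nonneg_simplex: "i < n \<Longrightarrow> xs \<in> simplices V m i \<Longrightarrow> 0 \<le> m i xs"
  by (rule less_imp_le[OF simplex_weight_pos])

lemma weighted_square_nonneg:
  "i < n \<Longrightarrow> xs \<in> simplices V m i \<Longrightarrow> 0 \<le> m i xs * (cmod z)\<^sup>2"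
  by (intro mult_nonneg_nonneg zero_le_power2 weight_nonneg_simplex)

lemma sqnorm_nonneg: "i < n \<Longrightarrow> 0 \<le> sqnorm i f"
  unfolding sqnorm_def by (intro infsum_nonneg) (simp add: weight_nonneg_simplex)

lemma l2_add:
  assumes i: "i < n" and f: "f \<in> l2 V m i" and g: "g \<in> l2 V m i"
  shows "f + g \<in> l2 V m i" and "sqnorm i (f + g) \<le> 2 * sqnorm i f + 2 * sqnorm i g"
proof -
  have sum: "((\<lambda>xs. 2 * (m i xs * (cmod (f xs))\<^sup>2) + 2 * (m i xs * (cmod (g xs))\<^sup>2))
      has_sum (2 * sqnorm i f + 2 * sqnorm i g)) (simplices V m i)"
    by (intro has_sum_add has_sum_cmult_right l2_has_sum f g)
  have le: "m i xs * (cmod ((f + g) xs))\<^sup>2 \<le> 2 * (m i xs * (cmod (f xs))\<^sup>2) + 2 * (m i xs * (cmod (g xs))\<^sup>2)"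
    if "xs \<in> simplices V m i" for xs
    using weighted_square_add_le[of "m i xs" "f xs" "g xs"] weight_nonneg_simplex[OF i that] by simp
  have "(\<lambda>xs. m i xs * (cmod ((f + g) xs))\<^sup>2) summable_on simplices V m i"
    by (rule summable_on_comparison_test[OF has_sum_imp_summable[OF sum] le])
       (assumption | rule weighted_square_nonneg[OF i])+
  with f g show mem: "f + g \<in> l2 V m i"
    by (simp add: l2_def alternating_add)
  show "sqnorm i (f + g) \<le> 2 * sqnorm i f + 2 * sqnorm i g"
    by (rule has_sum_mono[OF l2_has_sum[OF mem] sum le])
qed

lemma l2_scale:
  assumes "f \<in> l2 V m i"
  shows "(\<lambda>xs. c * f xs) \<in> l2 V m i"
proof -
  have "(\<lambda>xs. (cmod c)\<^sup>2 * (m i xs * (cmod (f xs))\<^sup>2)) summable_on simplices V m i"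
    using l2_has_sum[OF assms] by (intro summable_on_cmult_right has_sum_imp_summable)
  then show ?thesis
    using assms by (simp add: l2_def alternating_scale norm_mult power_mult_distrib ac_simps)
qed

lemma l2_0: "0 \<in> l2 V m i"
  by (simp add: l2_def alternating_0)

lemma cochains_c_subset_l2: "cochains_c V m i \<subseteq> l2 V m i"
proof
  fix f assume f: "f \<in> cochains_c V m i"
  have "(\<lambda>xs. m i xs * (cmod (f xs))\<^sup>2) summable_on simplices V m i"
    by (rule finite_nonzero_values_imp_summable_on)
       (use f in \<open>auto simp: cochains_c_def intro: finite_subset[of _ "{xs. f xs \<noteq> 0}"]\<close>)
  then show "f \<in> l2 V m i"
    using f by (simp add: l2_def cochains_c_def)
qed

lemma inner_summable:
  assumes "i < n" "f \<in> l2 V m i" "g \<in> l2 V m i"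
  shows "(\<lambda>xs. of_real (m i xs) * cnj (f xs) * g xs) summable_on simplices V m i"
  using assms by (intro weighted_product_summable weight_nonneg_simplex) (auto simp: l2_def)

lemma inner_l2_add_right:
  assumes "i < n" "f \<in> l2 V m i" "g \<in> l2 V m i" "h \<in> l2 V m i"
  shows "inner_l2 V m i f (g + h) = inner_l2 V m i f g + inner_l2 V m i f h"
  using infsum_add[OF inner_summable[OF assms(1,2,3)] inner_summable[OF assms(1,2,4)]]
  by (simp add: inner_l2_def algebra_simps)

lemma inner_l2_scale_right: "inner_l2 V m i f (\<lambda>xs. c * g xs) = c * inner_l2 V m i f g"
proof -
  have "(\<Sum>\<^sub>\<infinity>xs\<in>simplices V m i. of_real (m i xs) * cnj (f xs) * (c * g xs))
    = c * (\<Sum>\<^sub>\<infinity>xs\<in>simplices V m i. of_real (m i xs) * cnj (f xs) * g xs)"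
    by (subst infsum_cmult_right'[symmetric]) (simp add: ac_simps)
  then show ?thesis by (simp add: inner_l2_def)
qed

lemma inner_l2_0_right: "inner_l2 V m i f 0 = 0"
  by (simp add: inner_l2_def)

lemma inner_l2_cnj: "inner_l2 V m i g f = cnj (inner_l2 V m i f g)"
  by (simp add: inner_l2_def infsum_cnj[symmetric] ac_simps del: infsum_cnj)

lemma inner_l2_self:
  assumes "f \<in> l2 V m i"
  shows "inner_l2 V m i f f = of_real (sqnorm i f / fact (Suc i))"
proof -
  have "of_real (m i xs) * cnj (f xs) * f xs = of_real (m i xs * (cmod (f xs))\<^sup>2)" for xs
    unfolding of_real_mult complex_norm_square by (simp only: ac_simps)
  then have "((\<lambda>xs. of_real (m i xs) * cnj (f xs) * f xs) has_sum of_real (sqnorm i f)) (simplices V m i)"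
    using has_sum_of_real[OF l2_has_sum[OF assms]] by (simp only:)
  from infsumI[OF this] show ?thesis by (simp add: inner_l2_def)
qed

lemma Re_inner_l2_self: "f \<in> l2 V m i \<Longrightarrow> Re (inner_l2 V m i f f) = sqnorm i f / fact (Suc i)"
  by (simp only: inner_l2_self Re_complex_of_real)

lemma sqnorm_eq_0D:
  assumes "i < n" "f \<in> l2 V m i" "sqnorm i f = 0"
  shows "f = 0"
proof
  fix xs
  show "f xs = 0 xs"
  proof (cases "xs \<in> simplices V m i")
    case True
    have "m i xs * (cmod (f xs))\<^sup>2 = 0"
      by (rule nonneg_infsum_le_0D[of "\<lambda>xs. m i xs * (cmod (f xs))\<^sup>2" "simplices V m i"])
         (use assms True in \<open>auto simp: sqnorm_def l2_def weight_nonneg_simplex\<close>)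
    then show ?thesis using simplex_weight_pos[OF assms(1) True] by simp
  next
    case False
    have "f \<in> alternating V m i" using assms(2) by (simp add: l2_def)
    from alternating_eq_0[OF this False] show ?thesis by simp
  qed
qed

lemma total_inner_self:
  assumes "F \<in> total_l2 V n m"
  shows "Re (total_inner V n m F F) = (\<Sum>i<n. sqnorm i (F i) / fact (Suc i))"
  using assms by (simp add: total_inner_def total_l2_def Re_inner_l2_self del: fact_Suc)

lemma total_l2_component: "F \<in> total_l2 V n m \<Longrightarrow> i < n \<Longrightarrow> F i \<in> l2 V m i"
  by (simp add: total_l2_def)

sublocale function_inner_product_space "total_l2 V n m" "total_inner V n m"
proof
  show "0 \<in> total_l2 V n m"
    by (simp add: total_l2_def l2_0)
  show "F + G \<in> total_l2 V n m" if "F \<in> total_l2 V n m" "G \<in> total_l2 V n m" for F G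
    using that by (auto simp: total_l2_def intro: l2_add)
  show "(\<lambda>i xs. c * F i xs) \<in> total_l2 V n m" if "F \<in> total_l2 V n m" for c F
    using that by (auto simp: total_l2_def fun_eq_iff intro: l2_scale)
  show "total_inner V n m F (G + K) = total_inner V n m F G + total_inner V n m F K"
    if "F \<in> total_l2 V n m" "G \<in> total_l2 V n m" "K \<in> total_l2 V n m" for F G K
    using that by (simp add: total_inner_def total_l2_component inner_l2_add_right sum.distrib)
  show "total_inner V n m F (\<lambda>i xs. c * G i xs) = c * total_inner V n m F G" for F G c
    by (simp add: total_inner_def inner_l2_scale_right sum_distrib_left)
  show "total_inner V n m G F = cnj (total_inner V n m F G)" for F G
    unfolding total_inner_def cnj_sum by (intro sum.cong refl inner_l2_cnj)
  show "0 \<le> Re (total_inner V n m F F)" if "F \<in> total_l2 V n m" for F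
    unfolding total_inner_self[OF that] by (intro sum_nonneg) (simp add: sqnorm_nonneg)
  show "F = 0" if F: "F \<in> total_l2 V n m" and zero: "Re (total_inner V n m F F) = 0" for F
  proof
    fix i
    show "F i = 0 i"
    proof (cases "i < n")
      case True
      have "\<forall>i\<in>{..<n}. sqnorm i (F i) / fact (Suc i) = 0"
        using zero unfolding total_inner_self[OF F]
        by (subst sum_nonneg_eq_0_iff[symmetric]) (auto simp: sqnorm_nonneg)
      then have "sqnorm i (F i) = 0" using True by simp
      then show ?thesis using sqnorm_eq_0D[OF True] F True by (simp add: total_l2_def)
    next
      case False
      then show ?thesis using F by (simp add: total_l2_def)
    qed
  qed
qed

text \<open>
  The cutoff is made on vertices, not on individual ordered simplices, so that it treats all
  orderings of a simplex alike.
\<close>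

definition restrict_cochain :: "'v set \<Rightarrow> ('v list \<Rightarrow> complex) \<Rightarrow> 'v list \<Rightarrow> complex" where
  "restrict_cochain B f xs = (if set xs \<subseteq> B then f xs else 0)"

lemma restrict_cochain_in_cochains_c:
  assumes f: "f \<in> alternating V m i" and "finite B"
  shows "restrict_cochain B f \<in> cochains_c V m i"
proof -
  have "{xs. restrict_cochain B f xs \<noteq> 0} \<subseteq> {xs. set xs \<subseteq> B \<and> length xs = Suc i}"
  proof
    fix xs assume "xs \<in> {xs. restrict_cochain B f xs \<noteq> 0}"
    then have "f xs \<noteq> 0" "set xs \<subseteq> B"
      by (auto simp: restrict_cochain_def split: if_splits)
    moreover from this have "xs \<in> simplices V m i"
      using alternating_eq_0[OF f] by blast
    ultimately show "xs \<in> {xs. set xs \<subseteq> B \<and> length xs = Suc i}"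
      using simplicesD(1) by auto
  qed
  moreover have "finite {xs. set xs \<subseteq> B \<and> length xs = Suc i}"
    using \<open>finite B\<close> by (rule finite_lists_length_eq)
  ultimately have "finite {xs. restrict_cochain B f xs \<noteq> 0}"
    by (rule finite_subset)
  then show ?thesis
    using f by (auto simp: cochains_c_def alternating_def restrict_cochain_def)
qed

text \<open>
  All but a small part of the norm sits on finitely many simplices. Their vertices form a finite
  set, and no larger set increases the error, which lets one set serve all degrees at once.
\<close>

lemma restrict_cochain_approximates:
  assumes i: "i < n" and f: "f \<in> l2 V m i" and "0 < e"
  shows "\<exists>B. finite B \<and> (\<forall>B'. B \<subseteq> B' \<longrightarrow> finite B' \<longrightarrow> sqnorm i (restrict_cochain B' f - f) \<le> e)"
proof -
  let ?S = "simplices V m i" and ?a = "\<lambda>xs. m i xs * (cmod (f xs))\<^sup>2"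
  have a: "(?a has_sum sqnorm i f) ?S" by (rule l2_has_sum[OF f])
  then obtain X where X: "finite X" "X \<subseteq> ?S" and near: "dist (sum ?a X) (sqnorm i f) \<le> e"
    using has_sum_finite_approximation[OF a \<open>0 < e\<close>] by auto
  have tail: "(?a has_sum (sqnorm i f - sum ?a X)) (?S - X)"
    using X by (intro has_sum_Diff a has_sum_finite)
  have "sqnorm i (restrict_cochain B' f - f) \<le> e" if B': "(\<Union>xs\<in>X. set xs) \<subseteq> B'" "finite B'" for B'
  proof -
    let ?h = "restrict_cochain B' f - f"
    have h_eq: "?h = restrict_cochain B' f + (\<lambda>xs. -1 * f xs)" by (simp add: fun_eq_iff)
    have "restrict_cochain B' f \<in> l2 V m i"
      using restrict_cochain_in_cochains_c[of f i B'] B' f cochains_c_subset_l2 by (auto simp: l2_def)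
    then have h: "?h \<in> l2 V m i"
      unfolding h_eq by (intro l2_add(1) i l2_scale f)
    have "sqnorm i ?h \<le> sqnorm i f - sum ?a X"
      by (rule has_sum_mono_neutral[OF l2_has_sum[OF h] tail])
         (use B' i in \<open>auto simp: restrict_cochain_def weight_nonneg_simplex\<close>)
    also have "\<dots> \<le> e" using near by (simp add: dist_real_def)
    finally show ?thesis .
  qed
  with X show ?thesis by (intro exI[of _ "\<Union>xs\<in>X. set xs"]) auto
qed

lemma total_cochains_c_subset: "total_cochains_c V n m \<subseteq> total_l2 V n m"
  using cochains_c_subset_l2 by (auto simp: total_cochains_c_def total_l2_def)

lemma total_cochains_c_dense: "dense_in (total_l2 V n m) (total_inner V n m) (total_cochains_c V n m)"
  unfolding dense_in_def
proof (intro ballI allI impI)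
  fix u and e :: real assume u: "u \<in> total_l2 V n m" and e: "0 < e"
  \<comment> \<open>The total error is at most \<open>n d\<close>, which has to stay strictly below \<open>e\<^sup>2\<close>.\<close>
  define d where "d = e\<^sup>2 / (2 * n)"
  have d: "0 < d" using e n_ge_2 by (simp add: d_def)
  have "\<forall>i\<in>{..<n}. \<exists>B. finite B \<and>
      (\<forall>B'. B \<subseteq> B' \<longrightarrow> finite B' \<longrightarrow> sqnorm i (restrict_cochain B' (u i) - u i) \<le> d)"
    using restrict_cochain_approximates[OF _ total_l2_component[OF u] d] by auto
  then obtain B where fin: "\<And>i. i < n \<Longrightarrow> finite (B i)"
    and B: "\<And>i B'. \<lbrakk>i < n; B i \<subseteq> B'; finite B'\<rbrakk> \<Longrightarrow> sqnorm i (restrict_cochain B' (u i) - u i) \<le> d"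
    by (simp only: lessThan_iff Ball_def bchoice_iff) metis
  define A where "A = (\<Union>i<n. B i)"
  define f where "f = (\<lambda>i. restrict_cochain A (u i))"
  have A: "finite A" "\<And>i. i < n \<Longrightarrow> B i \<subseteq> A" using fin by (auto simp: A_def)
  have f: "f \<in> total_cochains_c V n m"
    unfolding total_cochains_c_def mem_Collect_eq
  proof (intro conjI allI impI)
    show "f i \<in> cochains_c V m i" if "i < n" for i
      using total_l2_component[OF u that] A(1) by (auto simp: f_def l2_def intro: restrict_cochain_in_cochains_c)
    show "f i = 0" if "n \<le> i" for i
      using u that by (simp add: f_def total_l2_def restrict_cochain_def fun_eq_iff)
  qed
  then have diff: "f - u \<in> total_l2 V n m"
    using total_cochains_c_subset u by (intro diff_mem) auto
  have "Re (total_inner V n m (f - u) (f - u)) = (\<Sum>i<n. sqnorm i (restrict_cochain A (u i) - u i) / fact (Suc i))"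
    unfolding total_inner_self[OF diff] by (simp add: f_def)
  also have "\<dots> \<le> (\<Sum>i<n. d)"
  proof (rule sum_mono)
    fix i assume "i \<in> {..<n}"
    then have i: "i < n" by simp
    have "sqnorm i (restrict_cochain A (u i) - u i) / fact (Suc i)
        \<le> sqnorm i (restrict_cochain A (u i) - u i) / 1"
      by (intro divide_left_mono fact_ge_1) (auto simp: sqnorm_nonneg i)
    also have "\<dots> \<le> d" using B[OF i A(2)[OF i] A(1)] by simp
    finally show "sqnorm i (restrict_cochain A (u i) - u i) / fact (Suc i) \<le> d" .
  qed
  also have "\<dots> = e\<^sup>2 / 2" using n_ge_2 by (simp add: d_def)
  also have "\<dots> < e\<^sup>2" using e by simp
  finally have "hnorm (total_inner V n m) (f - u) < e"
    using e by (simp add: hnorm_def real_less_lsqrt)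
  with f show "\<exists>f\<in>total_cochains_c V n m. hnorm (total_inner V n m) (f - u) < e" by blast
qed

end

section \<open>Boundedness and adjointness of the differentials\<close>

locale bounded_degree_complex = locally_finite_complex V n m
  for V :: "'v set" and n :: nat and m :: "'v weights" +
  fixes M :: real
  assumes M_nonneg: "0 \<le> M"
    and weighted_degree_le: "\<lbrakk>Suc i < n; xs \<in> simplices V m i\<rbrakk> \<Longrightarrow> weighted_degree V m i xs \<le> M"
begin

lemma sum_weights_eq_degree:
  assumes "Suc i < n" "xs \<in> simplices V m i"
  shows "(\<Sum>y\<in>common_neighbours V m xs. m (Suc i) (xs @ [y])) = m i xs * weighted_degree V m i xs"
  using simplex_weight_pos[of i xs] assms by (simp add: weighted_degree_def)

lemma degree_nonneg:
  assumes "Suc i < n" "xs \<in> simplices V m i"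
  shows "0 \<le> weighted_degree V m i xs"
  using assms weight_nonneg_simplex[of i xs] unfolding weighted_degree_def
  by (intro mult_nonneg_nonneg sum_nonneg weight_nonneg_simplex) (auto simp: simplex_snoc_iff)

text \<open>
  The place where the degree bound acts: summing out the last vertex of an \<open>(i + 1)\<close>-simplex
  multiplies the weight of the remaining \<open>i\<close>-simplex by its weighted degree.
\<close>

lemma has_sum_forget_last_vertex:
  fixes h :: "'v list \<Rightarrow> real"
  assumes i: "Suc i < n" and h: "\<And>xs. 0 \<le> h xs"
    and sum: "((\<lambda>xs. m i xs * h xs) has_sum s) (simplices V m i)"
  shows "\<exists>t\<le>M * s. ((\<lambda>zs. m (Suc i) zs * h (butlast zs)) has_sum t) (simplices V m (Suc i))"
proof -
  let ?S = "simplices V m i" and ?N = "common_neighbours V m"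
  let ?F = "\<lambda>(xs, y). m (Suc i) (xs @ [y]) * h xs"
  let ?g = "\<lambda>xs. m i xs * weighted_degree V m i xs * h xs"
  have F: "((\<lambda>y. ?F (xs, y)) has_sum ?g xs) (?N xs)" if "xs \<in> ?S" for xs
    using has_sum_finite[OF finite_common_neighbours[OF that], of "\<lambda>y. ?F (xs, y)"]
      sum_weights_eq_degree[OF i that] by (simp add: sum_distrib_right[symmetric])
  have Ms: "((\<lambda>xs. M * (m i xs * h xs)) has_sum M * s) ?S"
    by (intro has_sum_cmult_right sum)
  have g_le: "?g xs \<le> M * (m i xs * h xs)" if "xs \<in> ?S" for xs
  proof -
    have "weighted_degree V m i xs * (m i xs * h xs) \<le> M * (m i xs * h xs)"
      using i that h by (intro mult_right_mono weighted_degree_le mult_nonneg_nonneg weight_nonneg_simplex) auto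
    then show ?thesis by (simp add: ac_simps)
  qed
  have g: "?g summable_on ?S"
  proof (rule summable_on_comparison_test[OF has_sum_imp_summable[OF Ms] g_le])
    show "0 \<le> ?g xs" if "xs \<in> ?S" for xs
      using i that h by (intro mult_nonneg_nonneg weight_nonneg_simplex degree_nonneg) auto
  qed
  have "?F summable_on Sigma ?S ?N"
  proof (rule summable_on_SigmaI[OF F g])
    show "0 \<le> ?F (xs, y)" if "xs \<in> ?S" "y \<in> ?N xs" for xs y
      using i that h weight_nonneg_simplex[of "Suc i" "xs @ [y]"] by (simp add: simplex_snoc_iff)
  qed
  then have "(?F has_sum infsum ?g ?S) (Sigma ?S ?N)"
    by (intro has_sum_SigmaI[OF F has_sum_infsum[OF g]])
  moreover have F_eq: "?F = (\<lambda>p. (\<lambda>zs. m (Suc i) zs * h (butlast zs)) ((\<lambda>(xs, y). xs @ [y]) p))"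
    by (simp add: fun_eq_iff)
  ultimately have "((\<lambda>zs. m (Suc i) zs * h (butlast zs)) has_sum infsum ?g ?S) (simplices V m (Suc i))"
    unfolding F_eq by (intro has_sum_reindex_bij_betw[OF simplices_Suc_bij, THEN iffD1])
  moreover have "infsum ?g ?S \<le> M * s"
    by (rule has_sum_mono[OF has_sum_infsum[OF g] Ms g_le])
  ultimately show ?thesis by blast
qed

text \<open>
  Every face becomes the one opposite to the last vertex after a permutation that preserves the
  weights, so all faces contribute equally to sums over the simplices.
\<close>

lemma face_permutation:
  assumes i: "Suc i < n" and j: "j \<le> Suc i"
  obtains p where "p permutes {..<Suc (Suc i)}" "sign p = (-1) ^ (Suc i - j)"
    "bij_betw (permute_list p) (simplices V m (Suc i)) (simplices V m (Suc i))"
    "\<And>xs. xs \<in> simplices V m (Suc i) \<Longrightarrow> remove_nth j xs = butlast (permute_list p xs)"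
    "\<And>xs. xs \<in> simplices V m (Suc i) \<Longrightarrow> m (Suc i) (permute_list p xs) = m (Suc i) xs"
proof -
  obtain p where p: "p permutes {..<Suc (Suc i)}" "sign p = (-1) ^ (Suc (Suc i) - 1 - j)"
    and faces: "\<forall>xs :: 'v list. length xs = Suc (Suc i) \<longrightarrow> permute_list p xs = remove_nth j xs @ [xs ! j]"
    using remove_nth_append_eq_permute_list[of j "Suc (Suc i)"] j by auto
  show thesis
  proof (rule that[OF p(1) _ permute_list_bij_simplices[OF p(1)]])
    show "sign p = (-1) ^ (Suc i - j)" using p(2) by simp
    show "remove_nth j xs = butlast (permute_list p xs)" if "xs \<in> simplices V m (Suc i)" for xs
      using faces simplicesD(1)[OF that] by simp
    show "m (Suc i) (permute_list p xs) = m (Suc i) xs" if "xs \<in> simplices V m (Suc i)" for xs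
      using weight_permute_simplex[OF i that p(1)] .
  qed
qed

text \<open>
  One factor \<open>i + 2\<close> in the bound comes from estimating the square of a sum of \<open>i + 2\<close> terms by their
  squares, the other from the number of faces.
\<close>

lemma coboundary_l2:
  assumes i: "Suc i < n" and f: "f \<in> l2 V m i"
  shows "coboundary V m i f \<in> l2 V m (Suc i)"
    and "sqnorm (Suc i) (coboundary V m i f) \<le> (real (Suc (Suc i)))\<^sup>2 * M * sqnorm i f"
proof -
  let ?S = "simplices V m (Suc i)" and ?h = "\<lambda>xs. (cmod (f xs))\<^sup>2"
  let ?c = "real (Suc (Suc i))"
  obtain t where t: "t \<le> M * sqnorm i f" "((\<lambda>zs. m (Suc i) zs * ?h (butlast zs)) has_sum t) ?S"
    using has_sum_forget_last_vertex[OF i _ l2_has_sum[OF f]] by auto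
  have face: "((\<lambda>xs. m (Suc i) xs * ?h (remove_nth j xs)) has_sum t) ?S" if j: "j \<in> {..Suc i}" for j
  proof -
    from j have "j \<le> Suc i" by simp
    then obtain p where "p permutes {..<Suc (Suc i)}" "sign p = (-1) ^ (Suc i - j)"
      and bij: "bij_betw (permute_list p) ?S ?S"
      and p: "\<And>xs. xs \<in> ?S \<Longrightarrow> remove_nth j xs = butlast (permute_list p xs)"
        "\<And>xs. xs \<in> ?S \<Longrightarrow> m (Suc i) (permute_list p xs) = m (Suc i) xs"
      by (rule face_permutation[OF i]) (rule that; assumption)
    have "((\<lambda>xs. m (Suc i) (permute_list p xs) * ?h (butlast (permute_list p xs))) has_sum t) ?S"
      by (rule has_sum_reindex_bij_betw[OF bij, THEN iffD2, OF t(2)])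
    then show ?thesis
      by (rule has_sum_cong[THEN iffD1, rotated]) (simp add: p)
  qed
  have dominating: "((\<lambda>xs. ?c * (\<Sum>j\<le>Suc i. m (Suc i) xs * ?h (remove_nth j xs))) has_sum ?c * (\<Sum>j\<le>Suc i. t)) ?S"
    by (intro has_sum_cmult_right has_sum_sum_index face)
  have le: "m (Suc i) xs * (cmod (coboundary V m i f xs))\<^sup>2
      \<le> ?c * (\<Sum>j\<le>Suc i. m (Suc i) xs * ?h (remove_nth j xs))" if xs: "xs \<in> ?S" for xs
  proof -
    have "cmod (coboundary V m i f xs) \<le> (\<Sum>j\<le>Suc i. cmod (f (remove_nth j xs)))"
      using norm_sum[of "\<lambda>j. (-1) ^ j * f (remove_nth j xs)" "{..Suc i}"] xs
      by (simp add: coboundary_def norm_mult norm_power del: sum.atMost_Suc)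
    then have "(cmod (coboundary V m i f xs))\<^sup>2 \<le> (\<Sum>j\<le>Suc i. cmod (f (remove_nth j xs)))\<^sup>2"
      by (intro power_mono) auto
    also have "\<dots> \<le> ?c * (\<Sum>j\<le>Suc i. ?h (remove_nth j xs))"
      using sum_squared_le_sum_of_squares[of "\<lambda>j. cmod (f (remove_nth j xs))" "{..Suc i}"]
      by (simp add: ac_simps del: sum.atMost_Suc)
    finally have "m (Suc i) xs * (cmod (coboundary V m i f xs))\<^sup>2
        \<le> m (Suc i) xs * (?c * (\<Sum>j\<le>Suc i. ?h (remove_nth j xs)))"
      using i xs by (intro mult_left_mono weight_nonneg_simplex)
    then show ?thesis
      by (simp only: sum_distrib_left[symmetric] mult.left_commute)
  qed
  have "(\<lambda>xs. m (Suc i) xs * (cmod (coboundary V m i f xs))\<^sup>2) summable_on ?S"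
    by (rule summable_on_comparison_test[OF has_sum_imp_summable[OF dominating] le])
       (assumption | rule weighted_square_nonneg[OF i])+
  then show mem: "coboundary V m i f \<in> l2 V m (Suc i)"
    using f by (simp add: l2_def coboundary_alternating)
  have "sqnorm (Suc i) (coboundary V m i f) \<le> ?c * (\<Sum>j\<le>Suc i. t)"
    by (rule has_sum_mono[OF l2_has_sum[OF mem] dominating le])
  also have "\<dots> = ?c\<^sup>2 * t"
    by (simp add: power2_eq_square del: sum.atMost_Suc)
  also have "\<dots> \<le> ?c\<^sup>2 * (M * sqnorm i f)"
    using t(1) by (intro mult_left_mono) auto
  finally show "sqnorm (Suc i) (coboundary V m i f) \<le> ?c\<^sup>2 * M * sqnorm i f"
    by (simp only: mult.assoc)
qed

text \<open>
  Cauchy-Schwarz with respect to the weights \<open>m (Suc i) (xs @ [y])\<close> bounds the square of the sum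
  over \<open>y\<close> by \<open>m i xs\<close> times the degree of \<open>xs\<close> times the weighted sum of squares. This factor \<open>m i xs\<close> and
  the one in the norm cancel the square of the denominator of \<open>\<delta>\<close>.
\<close>

lemma codifferential_l2:
  assumes i: "Suc i < n" and g: "g \<in> l2 V m (Suc i)"
  shows "codifferential V m (Suc i) g \<in> l2 V m i"
    and "sqnorm i (codifferential V m (Suc i) g) \<le> M * sqnorm (Suc i) g"
proof -
  let ?S = "simplices V m i" and ?N = "common_neighbours V m"
  let ?F = "\<lambda>(xs, y). m (Suc i) (xs @ [y]) * (cmod (g (xs @ [y])))\<^sup>2"
  let ?G = "\<lambda>xs. \<Sum>y\<in>?N xs. ?F (xs, y)"
  have F_eq: "?F = (\<lambda>p. (\<lambda>zs. m (Suc i) zs * (cmod (g zs))\<^sup>2) ((\<lambda>(xs, y). xs @ [y]) p))"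
    by (simp add: fun_eq_iff)
  have "(?F has_sum sqnorm (Suc i) g) (Sigma ?S ?N)"
    unfolding F_eq by (rule has_sum_reindex_bij_betw[OF simplices_Suc_bij, THEN iffD2, OF l2_has_sum[OF g]])
  then have "(?G has_sum sqnorm (Suc i) g) ?S"
    by (rule has_sum_SigmaD) (rule has_sum_finite[OF finite_common_neighbours])
  then have dominating: "((\<lambda>xs. M * ?G xs) has_sum M * sqnorm (Suc i) g) ?S"
    by (rule has_sum_cmult_right)
  have le: "m i xs * (cmod (codifferential V m (Suc i) g xs))\<^sup>2 \<le> M * ?G xs" if xs: "xs \<in> ?S" for xs
  proof -
    define w where "w = (\<lambda>y. m (Suc i) (xs @ [y]))"
    define a where "a = (\<lambda>y. cmod (g (xs @ [y])))"
    have w: "0 \<le> w y" if "y \<in> ?N xs" for y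
      unfolding w_def using that xs i by (intro weight_nonneg_simplex) (auto simp: simplex_snoc_iff)
    have pos: "0 < m i xs" using i xs by (intro simplex_weight_pos) auto
    have "cmod (\<Sum>y\<in>?N xs. of_real (w y) * g (xs @ [y])) \<le> (\<Sum>y\<in>?N xs. w y * a y)"
      using w by (intro sum_norm_le) (simp add: norm_mult a_def)
    then have "(cmod (\<Sum>y\<in>?N xs. of_real (w y) * g (xs @ [y])))\<^sup>2 \<le> (\<Sum>y\<in>?N xs. w y * a y)\<^sup>2"
      by (intro power_mono) auto
    also have "(\<Sum>y\<in>?N xs. w y * a y) = (\<Sum>y\<in>?N xs. sqrt (w y) * (sqrt (w y) * a y))"
      using w by (intro sum.cong refl) (simp add: mult.assoc[symmetric])
    also have "\<dots>\<^sup>2 \<le> (\<Sum>y\<in>?N xs. (sqrt (w y))\<^sup>2) * (\<Sum>y\<in>?N xs. (sqrt (w y) * a y)\<^sup>2)"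
      by (rule Cauchy_Schwarz_ineq_sum)
    also have "(\<Sum>y\<in>?N xs. (sqrt (w y) * a y)\<^sup>2) = ?G xs"
      using w by (intro sum.cong refl) (simp add: power_mult_distrib w_def a_def)
    also have "(\<Sum>y\<in>?N xs. (sqrt (w y))\<^sup>2) = m i xs * weighted_degree V m i xs"
      using w by (simp add: sum_weights_eq_degree[OF i xs, symmetric] w_def)
    also have "m i xs * weighted_degree V m i xs * ?G xs \<le> m i xs * M * ?G xs"
      using pos w weighted_degree_le[OF i xs]
      by (intro mult_right_mono mult_left_mono sum_nonneg) (auto simp: w_def)
    finally have "(cmod (\<Sum>y\<in>?N xs. of_real (w y) * g (xs @ [y])))\<^sup>2 \<le> m i xs * (M * ?G xs)"
      by (simp only: mult.assoc)
    moreover have "cmod (codifferential V m (Suc i) g xs)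
        = cmod (\<Sum>y\<in>?N xs. of_real (w y) * g (xs @ [y])) / m i xs"
      using xs pos by (simp add: codifferential_def w_def norm_mult norm_divide norm_power)
    then have "m i xs * (cmod (codifferential V m (Suc i) g xs))\<^sup>2
        = (cmod (\<Sum>y\<in>?N xs. of_real (w y) * g (xs @ [y])))\<^sup>2 / m i xs"
      using pos by (simp add: power_divide power2_eq_square)
    ultimately show ?thesis
      using pos by (simp add: pos_divide_le_eq mult.commute)
  qed
  have "(\<lambda>xs. m i xs * (cmod (codifferential V m (Suc i) g xs))\<^sup>2) summable_on ?S"
    by (rule summable_on_comparison_test[OF has_sum_imp_summable[OF dominating] le])
       (assumption | rule weighted_square_nonneg[OF Suc_lessD[OF i]])+
  then show mem: "codifferential V m (Suc i) g \<in> l2 V m i"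
    using g i by (simp add: l2_def codifferential_alternating)
  show "sqnorm i (codifferential V m (Suc i) g) \<le> M * sqnorm (Suc i) g"
    by (rule has_sum_mono[OF l2_has_sum[OF mem] dominating le])
qed

text \<open>
  Let \<open>B\<close> be the sum of \<open>m\<close> times the conjugate of \<open>f (butlast zs)\<close> times \<open>g zs\<close> over the
  \<open>(i + 1)\<close>-simplices \<open>zs\<close>. After moving vertex \<open>j\<close> to the end, the sign of that permutation combines
  with \<open>(-1)\<^sup>j\<close> to \<open>(-1)\<^sup>i\<^sup>+\<^sup>1\<close>, so each of the \<open>i + 2\<close> faces contributes \<open>(-1)\<^sup>i\<^sup>+\<^sup>1 B\<close> to the left side.
  This turns \<open>1/(i + 2)!\<close> into \<open>1/(i + 1)!\<close>. Summing over the last vertex first gives the right side.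
\<close>

lemma inner_coboundary_eq_inner_codifferential:
  assumes i: "Suc i < n" and f: "f \<in> l2 V m i" and g: "g \<in> l2 V m (Suc i)"
  shows "inner_l2 V m (Suc i) (coboundary V m i f) g = inner_l2 V m i f (codifferential V m (Suc i) g)"
proof -
  let ?S = "simplices V m i" and ?T = "simplices V m (Suc i)" and ?N = "common_neighbours V m"
  let ?b = "\<lambda>zs. of_real (m (Suc i) zs) * cnj (f (butlast zs)) * g zs"
  have g_alt: "g \<in> alternating V m (Suc i)" using g by (simp add: l2_def)
  define B where "B = infsum ?b ?T"
  obtain t where "((\<lambda>zs. m (Suc i) zs * (cmod (f (butlast zs)))\<^sup>2) has_sum t) ?T"
    using has_sum_forget_last_vertex[OF i _ l2_has_sum[OF f]] by auto
  then have "?b summable_on ?T"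
    using g i by (intro weighted_product_summable weight_nonneg_simplex)
      (auto simp: l2_def intro: has_sum_imp_summable)
  then have b: "(?b has_sum B) ?T" unfolding B_def by (rule has_sum_infsum)
  have face: "((\<lambda>xs. of_real (m (Suc i) xs) * cnj ((-1) ^ j * f (remove_nth j xs)) * g xs)
      has_sum (-1) ^ Suc i * B) ?T" if j: "j \<in> {..Suc i}" for j
  proof -
    from j have "j \<le> Suc i" by simp
    then obtain p where perm: "p permutes {..<Suc (Suc i)}" and sgn: "sign p = (-1) ^ (Suc i - j)"
      and bij: "bij_betw (permute_list p) ?T ?T"
      and p: "\<And>xs. xs \<in> ?T \<Longrightarrow> remove_nth j xs = butlast (permute_list p xs)"
        "\<And>xs. xs \<in> ?T \<Longrightarrow> m (Suc i) (permute_list p xs) = m (Suc i) xs"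
      by (rule face_permutation[OF i]) (rule that; assumption)
    have "((\<lambda>xs. ?b (permute_list p xs)) has_sum B) ?T"
      by (rule has_sum_reindex_bij_betw[OF bij, THEN iffD2, OF b])
    then have "((\<lambda>xs. (-1) ^ Suc i * ?b (permute_list p xs)) has_sum (-1) ^ Suc i * B) ?T"
      by (rule has_sum_cmult_right)
    moreover have "(-1) ^ Suc i * ?b (permute_list p xs)
        = of_real (m (Suc i) xs) * cnj ((-1) ^ j * f (remove_nth j xs)) * g xs" if xs: "xs \<in> ?T" for xs
    proof -
      have "(-1 :: complex) ^ Suc i * (-1) ^ (Suc i - j) = (-1) ^ (2 * (Suc i - j) + j)"
        using j by (simp only: power_add[symmetric]) (rule arg_cong[where f = "power (-1)"], simp)
      also have "\<dots> = (-1) ^ j" by (simp add: power_add power_mult)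
      finally have signs: "(-1 :: complex) ^ Suc i * (-1) ^ (Suc i - j) = (-1) ^ j" .
      have "g (permute_list p xs) = (-1) ^ (Suc i - j) * g xs"
        using alternating_permute_list[OF g_alt xs perm] by (simp add: sgn)
      then have "(-1) ^ Suc i * ?b (permute_list p xs)
          = ((-1) ^ Suc i * (-1) ^ (Suc i - j)) * (of_real (m (Suc i) xs) * cnj (f (remove_nth j xs)) * g xs)"
        by (simp only: p[OF xs] ac_simps)
      then show ?thesis
        unfolding signs by (simp add: ac_simps)
    qed
    ultimately show ?thesis
      by (subst has_sum_cong[where g = "\<lambda>xs. (-1) ^ Suc i * ?b (permute_list p xs)"]) simp_all
  qed
  have "((\<lambda>xs. \<Sum>j\<le>Suc i. of_real (m (Suc i) xs) * cnj ((-1) ^ j * f (remove_nth j xs)) * g xs)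
      has_sum (\<Sum>j\<le>Suc i. (-1) ^ Suc i * B)) ?T"
    by (intro has_sum_sum_index face)
  moreover have "(\<Sum>j\<le>Suc i. of_real (m (Suc i) xs) * cnj ((-1) ^ j * f (remove_nth j xs)) * g xs)
      = of_real (m (Suc i) xs) * cnj (coboundary V m i f xs) * g xs" if "xs \<in> ?T" for xs
    using that by (simp add: coboundary_def sum_distrib_left sum_distrib_right del: sum.atMost_Suc)
  ultimately have "((\<lambda>xs. of_real (m (Suc i) xs) * cnj (coboundary V m i f xs) * g xs)
      has_sum (\<Sum>j\<le>Suc i. (-1) ^ Suc i * B)) ?T"
    by (subst has_sum_cong[symmetric]) auto
  then have left: "inner_l2 V m (Suc i) (coboundary V m i f) g
      = 1 / fact (Suc (Suc i)) * (of_nat (Suc (Suc i)) * ((-1) ^ Suc i * B))"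
    unfolding inner_l2_def by (simp add: infsumI del: sum.atMost_Suc fact_Suc)
  let ?F = "\<lambda>(xs, y). of_real (m (Suc i) (xs @ [y])) * cnj (f xs) * g (xs @ [y])"
  have F_eq: "?F = (\<lambda>p. ?b ((\<lambda>(xs, y). xs @ [y]) p))"
    by (simp add: fun_eq_iff)
  have "(?F has_sum B) (Sigma ?S ?N)"
    unfolding F_eq by (rule has_sum_reindex_bij_betw[OF simplices_Suc_bij, THEN iffD2, OF b])
  then have "((\<lambda>xs. \<Sum>y\<in>?N xs. ?F (xs, y)) has_sum B) ?S"
    by (rule has_sum_SigmaD) (rule has_sum_finite[OF finite_common_neighbours])
  then have "((\<lambda>xs. (-1) ^ Suc i * (\<Sum>y\<in>?N xs. ?F (xs, y))) has_sum (-1) ^ Suc i * B) ?S"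
    by (rule has_sum_cmult_right)
  moreover have "(-1) ^ Suc i * (\<Sum>y\<in>?N xs. ?F (xs, y))
      = of_real (m i xs) * cnj (f xs) * codifferential V m (Suc i) g xs" if xs: "xs \<in> ?S" for xs
  proof -
    have "(\<Sum>y\<in>?N xs. ?F (xs, y)) = cnj (f xs) * (\<Sum>y\<in>?N xs. of_real (m (Suc i) (xs @ [y])) * g (xs @ [y]))"
      by (simp add: sum_distrib_left ac_simps)
    then show ?thesis
      using xs simplex_weight_pos[of i xs] i by (simp add: codifferential_def)
  qed
  ultimately have "((\<lambda>xs. of_real (m i xs) * cnj (f xs) * codifferential V m (Suc i) g xs)
      has_sum (-1) ^ Suc i * B) ?S"
    by (subst has_sum_cong[symmetric]) auto
  then have "inner_l2 V m i f (codifferential V m (Suc i) g) = 1 / fact (Suc i) * ((-1) ^ Suc i * B)"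
    unfolding inner_l2_def by (simp add: infsumI del: fact_Suc)
  moreover have "1 / fact (Suc (Suc i)) * of_nat (Suc (Suc i)) = (1 / fact (Suc i) :: complex)"
    unfolding fact_Suc[of "Suc i"] by (simp del: fact_Suc of_nat_Suc)
  ultimately show ?thesis
    unfolding left by (simp only: mult.assoc[symmetric])
qed

end

section \<open>The Gauss-Bonnet operator and the Hodge Laplacian\<close>

context bounded_degree_complex
begin

lemma gauss_bonnet_add: "gauss_bonnet V n m (F + G) = gauss_bonnet V n m F + gauss_bonnet V n m G"
  by (rule ext) (simp add: gauss_bonnet_def coboundary_add codifferential_add)

lemma gauss_bonnet_scale:
  "gauss_bonnet V n m (\<lambda>i xs. c * F i xs) = (\<lambda>i xs. c * gauss_bonnet V n m F i xs)"
  by (simp add: gauss_bonnet_def coboundary_scale codifferential_scale fun_eq_iff algebra_simps)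

lemma component_le_total:
  assumes "F \<in> total_l2 V n m" "i < n"
  shows "sqnorm i (F i) / fact (Suc i) \<le> Re (total_inner V n m F F)"
  unfolding total_inner_self[OF assms(1)] using assms(2)
  by (intro member_le_sum[of i "{..<n}" "\<lambda>i. sqnorm i (F i) / fact (Suc i)"]) (auto simp: sqnorm_nonneg)

text \<open>
  With the factorials of the inner products taken into account, one of the two factors \<open>i + 2\<close> of
  \<open>coboundary_l2\<close> cancels, and \<open>i + 2 \<le> n\<close>.
\<close>

lemma coboundary_component:
  assumes F: "F \<in> total_l2 V n m" and i: "Suc i < n"
  shows "sqnorm (Suc i) (coboundary V m i (F i)) / fact (Suc (Suc i))
    \<le> n * M * Re (total_inner V n m F F)"
proof -
  let ?c = "real (Suc (Suc i))" and ?N = "sqnorm i (F i) / fact (Suc i)"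
  have N: "0 \<le> ?N" using i by (simp add: sqnorm_nonneg)
  have "sqnorm (Suc i) (coboundary V m i (F i)) / fact (Suc (Suc i))
      \<le> ?c\<^sup>2 * M * sqnorm i (F i) / fact (Suc (Suc i))"
    using i by (intro divide_right_mono coboundary_l2 total_l2_component F) auto
  also have "\<dots> = ?c * M * ?N"
    unfolding fact_Suc[of "Suc i"] by (simp add: power2_eq_square del: fact_Suc of_nat_Suc)
  also have "\<dots> \<le> n * M * Re (total_inner V n m F F)"
    using i N M_nonneg component_le_total[OF F Suc_lessD[OF i]]
    by (intro mult_mono mult_nonneg_nonneg) auto
  finally show ?thesis .
qed

lemma codifferential_component:
  assumes F: "F \<in> total_l2 V n m" and i: "Suc i < n"
  shows "sqnorm i (codifferential V m (Suc i) (F (Suc i))) / fact (Suc i)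
    \<le> n * M * Re (total_inner V n m F F)"
proof -
  let ?c = "real (Suc (Suc i))" and ?N = "sqnorm (Suc i) (F (Suc i)) / fact (Suc (Suc i))"
  have N: "0 \<le> ?N" using i by (simp add: sqnorm_nonneg)
  have "sqnorm i (codifferential V m (Suc i) (F (Suc i))) / fact (Suc i)
      \<le> M * sqnorm (Suc i) (F (Suc i)) / fact (Suc i)"
    using i by (intro divide_right_mono codifferential_l2 total_l2_component F) auto
  also have "\<dots> = ?c * M * ?N"
    unfolding fact_Suc[of "Suc i"] by (simp del: fact_Suc of_nat_Suc)
  also have "\<dots> \<le> n * M * Re (total_inner V n m F F)"
    using i N M_nonneg component_le_total[OF F i]
    by (intro mult_mono mult_nonneg_nonneg) auto
  finally show ?thesis .
qed

text \<open>
  The constant is crude: the neighbouring components of \<open>F\<close> are each estimated by its full norm,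
  and the square of a sum of two terms by twice their squares.
\<close>

lemma gauss_bonnet_component:
  assumes F: "F \<in> total_l2 V n m" and i: "i < n"
  shows "gauss_bonnet V n m F i \<in> l2 V m i"
    and "sqnorm i (gauss_bonnet V n m F i) / fact (Suc i) \<le> 4 * n * M * Re (total_inner V n m F F)"
proof -
  let ?E = "Re (total_inner V n m F F)"
  define up where "up = (if 1 \<le> i \<and> i < n then coboundary V m (i - 1) (F (i - 1)) else 0)"
  define down where "down = (if i + 1 < n then codifferential V m (i + 1) (F (i + 1)) else 0)"
  have E: "0 \<le> n * M * ?E"
    using M_nonneg ip_nonneg[OF F] by simp
  have up: "up \<in> l2 V m i \<and> sqnorm i up / fact (Suc i) \<le> n * M * ?E"
  proof (cases i)
    case (Suc k)
    then show ?thesis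
      using coboundary_component[OF F, of k] coboundary_l2(1)[of k "F k"] total_l2_component[OF F, of k] i
      by (simp add: up_def del: fact_Suc)
  qed (use E in \<open>simp add: up_def l2_0 sqnorm_def\<close>)
  have down: "down \<in> l2 V m i \<and> sqnorm i down / fact (Suc i) \<le> n * M * ?E"
    using codifferential_component[OF F, of i] codifferential_l2(1)[of i "F (Suc i)"]
      total_l2_component[OF F, of "Suc i"] E
    by (simp add: down_def l2_0 sqnorm_def del: fact_Suc)
  have sum: "gauss_bonnet V n m F i = up + down"
    by (simp add: gauss_bonnet_def up_def down_def)
  show "gauss_bonnet V n m F i \<in> l2 V m i"
    unfolding sum using up down i by (intro l2_add) auto
  have "sqnorm i (up + down) / fact (Suc i) \<le> (2 * sqnorm i up + 2 * sqnorm i down) / fact (Suc i)"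
    using up down i by (intro divide_right_mono l2_add) auto
  also have "\<dots> = 2 * (sqnorm i up / fact (Suc i)) + 2 * (sqnorm i down / fact (Suc i))"
    by (simp only: add_divide_distrib times_divide_eq_right)
  also have "\<dots> \<le> 4 * n * M * ?E"
    using up down by linarith
  finally show "sqnorm i (gauss_bonnet V n m F i) / fact (Suc i) \<le> 4 * n * M * ?E"
    unfolding sum .
qed

lemma gauss_bonnet_total_l2:
  assumes F: "F \<in> total_l2 V n m"
  shows "gauss_bonnet V n m F \<in> total_l2 V n m"
  using gauss_bonnet_component(1)[OF F] by (simp add: total_l2_def gauss_bonnet_def[of V n m F])

lemma gauss_bonnet_bounded:
  assumes F: "F \<in> total_l2 V n m"
  shows "Re (total_inner V n m (gauss_bonnet V n m F) (gauss_bonnet V n m F))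
    \<le> 4 * n\<^sup>2 * M * Re (total_inner V n m F F)"
proof -
  have "Re (total_inner V n m (gauss_bonnet V n m F) (gauss_bonnet V n m F))
      \<le> (\<Sum>i<n. 4 * n * M * Re (total_inner V n m F F))"
    unfolding total_inner_self[OF gauss_bonnet_total_l2[OF F]]
    by (intro sum_mono gauss_bonnet_component(2) F) simp
  then show ?thesis by (simp add: power2_eq_square algebra_simps)
qed

text \<open>
  Moving \<open>\<delta>\<close> to the other side leaves an expression that goes over into its complex conjugate when
  \<open>F\<close> and \<open>G\<close> are exchanged; this is the symmetry of \<open>D\<close>.
\<close>

lemma total_inner_gauss_bonnet:
  assumes F: "F \<in> total_l2 V n m" and G: "G \<in> total_l2 V n m"
  shows "total_inner V n m F (gauss_bonnet V n m G) =
    (\<Sum>i<n - 1. inner_l2 V m (Suc i) (F (Suc i)) (coboundary V m i (G i)) +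
                 inner_l2 V m (Suc i) (coboundary V m i (F i)) (G (Suc i)))"
proof -
  obtain k where k: "n = Suc k" using n_ge_2 by (cases n) auto
  define up where "up = (\<lambda>i. if 1 \<le> i \<and> i < n then coboundary V m (i - 1) (G (i - 1)) else 0)"
  define down where "down = (\<lambda>i. if i + 1 < n then codifferential V m (i + 1) (G (i + 1)) else 0)"
  have up: "up i \<in> l2 V m i" if "i < n" for i
    using that coboundary_l2(1)[of "i - 1" "G (i - 1)"] total_l2_component[OF G, of "i - 1"]
    by (auto simp: up_def l2_0)
  have down: "down i \<in> l2 V m i" for i
    using codifferential_l2(1)[of i "G (Suc i)"] total_l2_component[OF G, of "Suc i"]
    by (auto simp: down_def l2_0)
  have "total_inner V n m F (gauss_bonnet V n m G)
      = (\<Sum>i<n. inner_l2 V m i (F i) (up i) + inner_l2 V m i (F i) (down i))"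
    unfolding total_inner_def
  proof (intro sum.cong refl)
    fix i assume "i \<in> {..<n}"
    then have i: "i < n" by simp
    have "gauss_bonnet V n m G i = up i + down i"
      by (simp add: gauss_bonnet_def up_def down_def)
    then show "inner_l2 V m i (F i) (gauss_bonnet V n m G i) = inner_l2 V m i (F i) (up i) + inner_l2 V m i (F i) (down i)"
      by (simp only: inner_l2_add_right[OF i total_l2_component[OF F i] up[OF i] down])
  qed
  also have "\<dots> = (\<Sum>i<Suc k. inner_l2 V m i (F i) (up i)) + (\<Sum>i<Suc k. inner_l2 V m i (F i) (down i))"
    by (simp only: sum.distrib k)
  also have "(\<Sum>i<Suc k. inner_l2 V m i (F i) (up i)) = (\<Sum>i<k. inner_l2 V m (Suc i) (F (Suc i)) (coboundary V m i (G i)))"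
    by (subst sum.lessThan_Suc_shift) (simp add: up_def k inner_l2_0_right)
  also have "(\<Sum>i<Suc k. inner_l2 V m i (F i) (down i)) = (\<Sum>i<k. inner_l2 V m (Suc i) (coboundary V m i (F i)) (G (Suc i)))"
    by (simp add: down_def k inner_l2_0_right inner_coboundary_eq_inner_codifferential
        total_l2_component[OF F] total_l2_component[OF G])
  finally show ?thesis by (simp add: k sum.distrib)
qed

lemma gauss_bonnet_symmetric:
  assumes F: "F \<in> total_l2 V n m" and G: "G \<in> total_l2 V n m"
  shows "total_inner V n m F (gauss_bonnet V n m G) = total_inner V n m (gauss_bonnet V n m F) G"
proof -
  have "total_inner V n m (gauss_bonnet V n m F) G = cnj (total_inner V n m G (gauss_bonnet V n m F))"
    by (rule ip_cnj[OF G gauss_bonnet_total_l2[OF F]])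
  also have "\<dots> = total_inner V n m F (gauss_bonnet V n m G)"
    unfolding total_inner_gauss_bonnet[OF F G] total_inner_gauss_bonnet[OF G F]
    by (simp add: inner_l2_cnj[symmetric] add.commute)
  finally show ?thesis ..
qed

theorem hodge_laplacian_essentially_self_adjoint:
  "essentially_self_adjoint (total_l2 V n m) (total_inner V n m) (total_cochains_c V n m) (hodge_laplacian V n m)"
proof (rule bounded_symmetric_essentially_self_adjoint)
  let ?D = "gauss_bonnet V n m" and ?C = "4 * n\<^sup>2 * M"
  show "hodge_laplacian V n m F \<in> total_l2 V n m" if "F \<in> total_l2 V n m" for F
    using that by (simp add: hodge_laplacian_def gauss_bonnet_total_l2)
  show "hodge_laplacian V n m (F + G) = hodge_laplacian V n m F + hodge_laplacian V n m G" for F G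
    by (simp add: hodge_laplacian_def gauss_bonnet_add)
  show "hodge_laplacian V n m (\<lambda>i xs. c * F i xs) = (\<lambda>i xs. c * hodge_laplacian V n m F i xs)" for c F
    by (simp add: hodge_laplacian_def gauss_bonnet_scale)
  show "total_inner V n m F (hodge_laplacian V n m G) = total_inner V n m (hodge_laplacian V n m F) G"
    if "F \<in> total_l2 V n m" "G \<in> total_l2 V n m" for F G
    using that by (simp add: hodge_laplacian_def gauss_bonnet_symmetric gauss_bonnet_total_l2)
  show "Re (total_inner V n m (hodge_laplacian V n m F) (hodge_laplacian V n m F))
      \<le> (?C * ?C) * Re (total_inner V n m F F)" if F: "F \<in> total_l2 V n m" for F
  proof -
    have "Re (total_inner V n m (?D (?D F)) (?D (?D F))) \<le> ?C * Re (total_inner V n m (?D F) (?D F))"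
      by (rule gauss_bonnet_bounded[OF gauss_bonnet_total_l2[OF F]])
    also have "\<dots> \<le> ?C * (?C * Re (total_inner V n m F F))"
      using M_nonneg by (intro mult_left_mono gauss_bonnet_bounded[OF F]) simp
    finally show ?thesis by (simp only: hodge_laplacian_def mult.assoc)
  qed
  show "total_cochains_c V n m \<subseteq> total_l2 V n m" by (rule total_cochains_c_subset)
  show "0 \<in> total_cochains_c V n m"
    by (simp add: total_cochains_c_def cochains_c_def alternating_0)
  show "F + G \<in> total_cochains_c V n m" if "F \<in> total_cochains_c V n m" "G \<in> total_cochains_c V n m" for F G
  proof -
    have "finite {xs. F i xs + G i xs \<noteq> 0}" if "i < n" for i
      using that \<open>F \<in> _\<close> \<open>G \<in> _\<close>
      by (auto simp: total_cochains_c_def cochains_c_def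
          intro: finite_subset[of _ "{xs. F i xs \<noteq> 0} \<union> {xs. G i xs \<noteq> 0}"])
    with that show ?thesis
      by (simp add: total_cochains_c_def cochains_c_def alternating_add)
  qed
  show "(\<lambda>i xs. c * F i xs) \<in> total_cochains_c V n m" if "F \<in> total_cochains_c V n m" for c F
    using that by (auto simp: total_cochains_c_def cochains_c_def alternating_scale fun_eq_iff)
  show "dense_in (total_l2 V n m) (total_inner V n m) (total_cochains_c V n m)"
    by (rule total_cochains_c_dense)
qed

end

text \<open>
  Dropping the set with index \<open>0\<close> loses no vertex, as it is contained in the next one.
\<close>

lemma cutoff_exhaustion_atLeast_1:
  assumes "cutoff_exhaustion UNIV V W \<eta>"
  shows "cutoff_exhaustion {1..} V W \<eta>"
proof -
  have "W 0 \<subseteq> W 1"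
    using assms by (auto simp: cutoff_exhaustion_def mono_on_def)
  have "(\<Union>k. W k) \<subseteq> (\<Union>k\<in>{1..}. W k)"
  proof (rule UN_least)
    fix k
    have "W k \<subseteq> W (max k 1)"
      using \<open>W 0 \<subseteq> W 1\<close> by (cases k) auto
    also have "\<dots> \<subseteq> (\<Union>k\<in>{1..}. W k)"
      by (rule UN_upper) simp
    finally show "W k \<subseteq> (\<Union>k\<in>{1..}. W k)" .
  qed
  then have "(\<Union>k\<in>{1..}. W k) = (\<Union>k. W k)"
    by blast
  then show ?thesis
    using assms unfolding cutoff_exhaustion_def mono_on_def by simp
qed

theorem corollary4p11:
  fixes V :: "'v set" and n :: nat and m :: "nat \<Rightarrow> 'v list \<Rightarrow> real"
  assumes "weighted_complex V n m"
    and "locally_finite V m"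
  shows
    "((\<exists>W \<eta>. cutoff_exhaustion {1..} V W \<eta>) \<and>
      (\<forall>i \<in> {0..n - 2}. bdd_above (weighted_degree V m i ` simplices V m i)) \<longrightarrow>
        (\<forall>F \<in> total_cochains_c V n m. \<forall>i<n.
           hodge_laplacian V n m F i = hodge_block V n m i (F i)) \<and>
        essentially_self_adjoint (total_l2 V n m) (total_inner V n m)
          (total_cochains_c V n m) (hodge_laplacian V n m)) \<and>
     (globally_chi_complete V n m \<longrightarrow> (\<exists>W \<eta>. cutoff_exhaustion {1..} V W \<eta>))"
proof -
  interpret locally_finite_complex V n m
    using assms by (simp add: locally_finite_complex_def locally_finite_complex_axioms_def)
  have blocks: "\<forall>F \<in> total_cochains_c V n m. \<forall>i<n. hodge_laplacian V n m F i = hodge_block V n m i (F i)"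
    by (intro ballI allI impI hodge_laplacian_eq_hodge_block)
       (auto simp: total_cochains_c_def cochains_c_def)
  have esa: "essentially_self_adjoint (total_l2 V n m) (total_inner V n m)
      (total_cochains_c V n m) (hodge_laplacian V n m)"
    if "\<forall>i \<in> {0..n - 2}. bdd_above (weighted_degree V m i ` simplices V m i)"
  proof -
    have "bdd_above (\<Union>i\<in>{0..n - 2}. weighted_degree V m i ` simplices V m i)"
      using that by simp
    then obtain M where M: "\<And>d. d \<in> (\<Union>i\<in>{0..n - 2}. weighted_degree V m i ` simplices V m i) \<Longrightarrow> d \<le> M"
      unfolding bdd_above_def by blast
    \<comment> \<open>A complex with no vertices admits a negative bound.\<close>
    interpret bounded_degree_complex V n m "max M 0"
    proof
      show "weighted_degree V m i xs \<le> max M 0" if "Suc i < n" "xs \<in> simplices V m i" for i xs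
        using that by (intro max.coboundedI1 M UN_I[of i]) auto
    qed simp
    show ?thesis by (rule hodge_laplacian_essentially_self_adjoint)
  qed
  have "\<exists>W \<eta>. cutoff_exhaustion {1..} V W \<eta>" if "globally_chi_complete V n m"
    using that cutoff_exhaustion_atLeast_1 unfolding globally_chi_complete_def by blast
  then show ?thesis
    using blocks by (intro conjI impI esa) (elim conjE, assumption)+
qed

end
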